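(* Let $\mathbb{F}$ be a field. There is a polynomial family $g=(g^{(n)})_{n\ge 1}$ in $\mathsf{VP}$ over $\mathbb{F}$, namely the Raz–Yehudayoff polynomial $g^{(n)}=g_{1,2n}$ in the variables $X=\{x_1,\ldots,x_{2n}\}$ and $\mathcal{W}=\{w_{i,k,j}\}_{i,k,j\in[2n]}$, and there are constants $c>0$, $n_0$, such that for every $n\ge n_0$ and all read-once polynomials $f_1,\ldots,f_s\in\mathbb{F}[X\cup\mathcal{W}]$: if $\sum_{i=1}^{s} f_i=g^{(n)}$, then $s\ge 2^{cn/\log n}$.
   Context: The Raz–Yehudayoff polynomial: for integers $i,j$ let $[i,j]=\{k\in\mathbb{N}: i\le k\le j\}$ and let $|[i,j]|$ be its length (number of elements). For each interval $[i,j]\subseteq[1,2n]$ of even length define $g_{i,j}=1$ if $|[i,j]|=0$, and if $|[i,j]|>0$, $$g_{i,j}=(1+x_ix_j)\,g_{i+1,j-1}+\sum_{k} w_{i,k,j}\,g_{i,k}\,g_{k+1,j},$$ where the sum is over those $k\in[i+1,j-2]$ such that $[i,k]$ has even length. Here all $x_k$ and $w_{i,k,j}$ are distinct variables. A read-once formula is a rooted binary tree whose leaves are labelled by variables or field elements, whose internal nodes are labelled $+$ or $\times$, and in which every variable labels at most one leaf. A read-once polynomial is a polynomial computed by a read-once formula. $\mathsf{VP}$ is the class of polynomial families of polynomially bounded degree computed by polynomial-size arithmetic circuits. *)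

theory Defs
  imports Complex_Main "HOL-Library.Poly_Mapping" "HOL-Computational_Algebra.Polynomial"
begin

section \<open>Multivariate polynomials\<close>

text \<open>Formal polynomials: finitely supported maps from monomials to coefficients, where a
  monomial is a finitely supported map from variables to exponents. The product of
  \<^typ>\<open>('v \<Rightarrow>\<^sub>0 nat) \<Rightarrow>\<^sub>0 'a\<close> is convolution, hence the usual product of polynomials.\<close>

type_synonym ('v, 'a) mpoly = "('v \<Rightarrow>\<^sub>0 nat) \<Rightarrow>\<^sub>0 'a"

definition mvar :: "'v \<Rightarrow> ('v, 'a::comm_ring_1) mpoly" where
  "mvar v = Poly_Mapping.single (Poly_Mapping.single v 1) 1"

definition mconst :: "'a::comm_ring_1 \<Rightarrow> ('v, 'a) mpoly" where
  "mconst c = Poly_Mapping.single 0 c"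

definition mpolys_over :: "'v set \<Rightarrow> ('v, 'a::comm_ring_1) mpoly set" where
  "mpolys_over V = {p. \<forall>m \<in> Poly_Mapping.keys p. Poly_Mapping.keys m \<subseteq> V}"

definition monom_degree :: "('v \<Rightarrow>\<^sub>0 nat) \<Rightarrow> nat" where
  "monom_degree m = (\<Sum>v \<in> Poly_Mapping.keys m. Poly_Mapping.lookup m v)"

text \<open>The zero polynomial gets degree 0.\<close>

definition total_degree :: "('v, 'a::comm_ring_1) mpoly \<Rightarrow> nat" where
  "total_degree p = Max (insert 0 (monom_degree ` Poly_Mapping.keys p))"


section \<open>Read-once polynomials\<close>

datatype ('v, 'a) formula =
    FVar 'v
  | FConst 'a
  | FAdd "('v, 'a) formula" "('v, 'a) formula"
  | FMult "('v, 'a) formula" "('v, 'a) formula"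

primrec formula_poly :: "('v, 'a::comm_ring_1) formula \<Rightarrow> ('v, 'a) mpoly" where
  "formula_poly (FVar v) = mvar v"
| "formula_poly (FConst c) = mconst c"
| "formula_poly (FAdd F G) = formula_poly F + formula_poly G"
| "formula_poly (FMult F G) = formula_poly F * formula_poly G"

primrec leaf_vars :: "('v, 'a) formula \<Rightarrow> 'v list" where
  "leaf_vars (FVar v) = [v]"
| "leaf_vars (FConst c) = []"
| "leaf_vars (FAdd F G) = leaf_vars F @ leaf_vars G"
| "leaf_vars (FMult F G) = leaf_vars F @ leaf_vars G"

definition read_once_formula :: "('v, 'a) formula \<Rightarrow> bool" where
  "read_once_formula F \<longleftrightarrow> distinct (leaf_vars F)"

definition read_once_poly :: "('v, 'a::comm_ring_1) mpoly \<Rightarrow> bool" where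
  "read_once_poly p \<longleftrightarrow> (\<exists>F. read_once_formula F \<and> formula_poly F = p)"


section \<open>Arithmetic circuits and the class VP\<close>

text \<open>A circuit is a list of gates in topological order: the numbers in a gate are the positions
  of its two children, which must occur strictly earlier in the list. The last gate is the output
  gate, and the size is the number of gates.\<close>

datatype ('v, 'a) gate =
    GVar 'v
  | GConst 'a
  | GAdd nat nat
  | GMult nat nat

type_synonym ('v, 'a) circuit = "('v, 'a) gate list"

primrec gate_wf :: "nat \<Rightarrow> ('v, 'a) gate \<Rightarrow> bool" where
  "gate_wf t (GVar v) \<longleftrightarrow> True"
| "gate_wf t (GConst c) \<longleftrightarrow> True"
| "gate_wf t (GAdd l r) \<longleftrightarrow> l < t \<and> r < t"
| "gate_wf t (GMult l r) \<longleftrightarrow> l < t \<and> r < t"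

definition circuit_wf :: "('v, 'a) circuit \<Rightarrow> bool" where
  "circuit_wf C \<longleftrightarrow> C \<noteq> [] \<and> (\<forall>t < length C. gate_wf t (C ! t))"

primrec gate_poly ::
    "('v, 'a::comm_ring_1) mpoly list \<Rightarrow> ('v, 'a) gate \<Rightarrow> ('v, 'a) mpoly" where
  "gate_poly ps (GVar v) = mvar v"
| "gate_poly ps (GConst c) = mconst c"
| "gate_poly ps (GAdd l r) = ps ! l + ps ! r"
| "gate_poly ps (GMult l r) = ps ! l * ps ! r"

definition circuit_polys :: "('v, 'a::comm_ring_1) circuit \<Rightarrow> ('v, 'a) mpoly list" where
  "circuit_polys C = foldl (\<lambda>ps G. ps @ [gate_poly ps G]) [] C"

definition circuit_computes :: "('v, 'a::comm_ring_1) circuit \<Rightarrow> ('v, 'a) mpoly \<Rightarrow> bool" where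
  "circuit_computes C p \<longleftrightarrow> circuit_wf C \<and> last (circuit_polys C) = p"

text \<open>Families are indexed by \<open>n \<ge> 1\<close>; the value at 0 is irrelevant.\<close>

definition in_VP :: "(nat \<Rightarrow> ('v, 'a::comm_ring_1) mpoly) \<Rightarrow> bool" where
  "in_VP f \<longleftrightarrow>
     (\<exists>b :: nat poly. \<forall>n \<ge> 1. total_degree (f n) \<le> poly b n) \<and>
     (\<exists>b :: nat poly. \<forall>n \<ge> 1. \<exists>C. circuit_computes C (f n) \<and> length C \<le> poly b n)"


section \<open>The Raz--Yehudayoff polynomial\<close>

datatype ry_var = X nat | W nat nat nat

text \<open>\<open>ry_interval i j\<close> is meaningful for \<open>i \<ge> 1\<close> and \<open>{i..j}\<close> of even length (then
  truncated subtraction plays no role); the recursion never leaves this domain. The values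
  elsewhere are junk.\<close>

function ry_interval :: "nat \<Rightarrow> nat \<Rightarrow> (ry_var, 'a::comm_ring_1) mpoly" where
  "ry_interval i j =
     (if card {i..j} = 0 then 1
      else (1 + mvar (X i) * mvar (X j)) * ry_interval (i + 1) (j - 1)
         + (\<Sum>k \<in> {k \<in> {i+1..j-2}. even (card {i..k})}.
              mvar (W i k j) * ry_interval i k * ry_interval (k + 1) j))"
  by pat_completeness auto
termination
  by (relation "measure (\<lambda>(i, j). Suc j - i)") auto

declare ry_interval.simps [simp del]

definition ry_poly :: "nat \<Rightarrow> (ry_var, 'a::comm_ring_1) mpoly" where
  "ry_poly n = ry_interval 1 (2 * n)"

definition ry_vars :: "nat \<Rightarrow> ry_var set" where
  "ry_vars n = X ` {1..2*n} \<union> {W i k j | i k j. {i, k, j} \<subseteq> {1..2*n}}"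

end

theory Submission
  imports Defs
begin

text \<open>Let \<open>A\<close> be half of the \<open>x\<close>-variables and \<open>B\<close> the other half. Some monomial in the
  \<open>w\<close>-variables has as its coefficient in the Raz--Yehudayoff polynomial a product of factors
  \<open>1 + x\<^sub>a x\<^sub>b\<close> over a perfect matching of \<open>A\<close> with \<open>B\<close>, so the matrix of its multilinear
  coefficients, with rows the subsets of \<open>A\<close> and columns the subsets of \<open>B\<close>, is a permutation
  matrix of rank \<open>2^n\<close>.

  For a read-once formula every such coefficient matrix has small rank on average over \<open>A\<close>:
  allowing an additive constant for free, a node with children of ranks \<open>r\<close> and \<open>r'\<close> has rank at
  most \<open>r r' + 1\<close>, and a subformula on two variables has rank 2 only if \<open>A\<close> separates them. This
  bounds the average of the rank over all \<open>A\<close> (balanced or not) by \<open>1.9975^n\<close>. As a fraction of at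
  least \<open>1/(2n)\<close> of all \<open>A\<close> is balanced, the number of summands is even at least
  \<open>(2/1.9975)^n/(2n)\<close>.\<close>

section \<open>Squarefree coefficients\<close>

text \<open>No single \<open>A\<close> can suffice: the product of the factors
  \<open>1 + x_a x_b\<close> over a fixed matching is read-once and has rank 2^n for every
  \<open>A\<close> separating its pairs. What singles out the Raz--Yehudayoff polynomial is that it
  reaches this rank for all balanced \<open>A\<close> at once. The price is a
  \<open>w\<close>-monomial that varies with \<open>A\<close>, so the bound for formulas must be
  uniform in that monomial; the \<open>w\<close>-variables are therefore carried along as
  parameters. Rank 2^n on 2n variables means a factor sqrt 2 per variable, so a saving on pairs left
  unseparated by a random \<open>A\<close> is enough. Unrestricted subsets are averaged because
  their traces on disjoint leaf sets are independent, whereas conditioning on balance destroys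
  independence. The ranks themselves do not multiply, because of the \<open>+ 1\<close>. They are
  majorized by a real weight that is multiplicative except where it is reset at pairs, and whose
  average factors along the formula.\<close>

definition sqfree_monom :: "'v set \<Rightarrow> 'v \<Rightarrow>\<^sub>0 nat" where
  "sqfree_monom K = (\<Sum>v\<in>K. Poly_Mapping.single v 1)"

definition sqfree_coeff :: "('v, 'a::comm_ring_1) mpoly \<Rightarrow> 'v set \<Rightarrow> 'a" where
  "sqfree_coeff p K = Poly_Mapping.lookup p (sqfree_monom K)"

lemma lookup_sqfree_monom:
  assumes "finite K"
  shows "Poly_Mapping.lookup (sqfree_monom K) v = (if v \<in> K then 1 else 0)"
  using assms by (simp add: sqfree_monom_def lookup_sum lookup_single when_def)

lemma keys_sqfree_monom [simp]: "finite K \<Longrightarrow> Poly_Mapping.keys (sqfree_monom K) = K"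
  by (auto simp: in_keys_iff lookup_sqfree_monom split: if_splits)

lemma sqfree_monom_Un:
  "finite K \<Longrightarrow> finite L \<Longrightarrow> K \<inter> L = {} \<Longrightarrow> sqfree_monom (K \<union> L) = sqfree_monom K + sqfree_monom L"
  by (simp add: sqfree_monom_def sum.union_disjoint)

lemma mpolys_over_mono: "p \<in> mpolys_over V \<Longrightarrow> V \<subseteq> V' \<Longrightarrow> p \<in> mpolys_over V'"
  by (auto simp: mpolys_over_def)

lemma mpolys_over_mvar: "v \<in> V \<Longrightarrow> mvar v \<in> mpolys_over V"
  by (simp add: mpolys_over_def mvar_def)

lemma mpolys_over_mconst: "mconst c \<in> mpolys_over V"
  by (simp add: mpolys_over_def mconst_def)

lemma mpolys_over_0: "0 \<in> mpolys_over V"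
  by (simp add: mpolys_over_def)

lemma mpolys_over_1: "1 \<in> mpolys_over V"
  by (simp add: mpolys_over_def)

lemma mpolys_over_add: "p \<in> mpolys_over V \<Longrightarrow> q \<in> mpolys_over V \<Longrightarrow> p + q \<in> mpolys_over V"
  using keys_add[of p q] by (fastforce simp: mpolys_over_def)

lemma mpolys_over_mult: "p \<in> mpolys_over V \<Longrightarrow> q \<in> mpolys_over V \<Longrightarrow> p * q \<in> mpolys_over V"
proof -
  assume *: "p \<in> mpolys_over V" "q \<in> mpolys_over V"
  have "Poly_Mapping.keys m \<subseteq> V" if m: "m \<in> Poly_Mapping.keys (p * q)" for m
  proof -
    obtain a b where "m = a + b" "a \<in> Poly_Mapping.keys p" "b \<in> Poly_Mapping.keys q"
      using keys_mult[of p q] m by blast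
    then show ?thesis
      using * keys_add[of a b] by (fastforce simp: mpolys_over_def)
  qed
  then show ?thesis
    by (simp add: mpolys_over_def)
qed

lemma mpolys_over_sum:
  "(\<And>i. i \<in> I \<Longrightarrow> f i \<in> mpolys_over V) \<Longrightarrow> sum f I \<in> mpolys_over V"
  by (induction I rule: infinite_finite_induct) (auto simp: mpolys_over_0 mpolys_over_add)

lemma sqfree_coeff_outside:
  assumes "p \<in> mpolys_over V" "finite K" "\<not> K \<subseteq> V"
  shows "sqfree_coeff p K = 0"
proof (rule ccontr)
  assume "sqfree_coeff p K \<noteq> 0"
  then have "sqfree_monom K \<in> Poly_Mapping.keys p"
    by (simp add: sqfree_coeff_def in_keys_iff)
  then have "Poly_Mapping.keys (sqfree_monom K) \<subseteq> V"
    using assms(1) by (simp add: mpolys_over_def)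
  then show False
    using assms by simp
qed

lemma sqfree_coeff_add [simp]: "sqfree_coeff (p + q) K = sqfree_coeff p K + sqfree_coeff q K"
  by (simp add: sqfree_coeff_def lookup_add)

lemma sqfree_coeff_sum: "sqfree_coeff (sum f I) K = (\<Sum>i\<in>I. sqfree_coeff (f i) K)"
  by (simp add: sqfree_coeff_def lookup_sum)

lemma sqfree_monom_eq_iff:
  assumes "finite K" "finite L"
  shows "sqfree_monom K = sqfree_monom L \<longleftrightarrow> K = L"
  using assms keys_sqfree_monom by metis

lemma sqfree_coeff_one: "finite K \<Longrightarrow> sqfree_coeff 1 K = (if K = {} then 1 else 0)"
  using sqfree_monom_eq_iff[of K "{}"]
  by (simp add: sqfree_coeff_def lookup_one when_def sqfree_monom_def)

lemma sqfree_coeff_mvar: "finite K \<Longrightarrow> sqfree_coeff (mvar v) K = (if K = {v} then 1 else 0)"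
  using sqfree_monom_eq_iff[of "{v}" K]
  by (auto simp: sqfree_coeff_def mvar_def lookup_single when_def sqfree_monom_def)

text \<open>Disjoint variable sets leave one term of the convolution: a factorization of the
  monomial into one over \<open>V\<close> and one over \<open>V'\<close> must be its restriction to
  \<open>V\<close> and to the complement.\<close>

lemma sqfree_coeff_mult:
  assumes p: "p \<in> mpolys_over V" and q: "q \<in> mpolys_over V'" and disj: "V \<inter> V' = {}"
    and K: "finite K"
  shows "sqfree_coeff (p * q) K = sqfree_coeff p (K \<inter> V) * sqfree_coeff q (K - V)"
proof -
  let ?k = "sqfree_monom K" and ?l = "sqfree_monom (K \<inter> V)" and ?r = "sqfree_monom (K - V)"
  have split: "?k = ?l + ?r"
    using sqfree_monom_Un[of "K \<inter> V" "K - V"] K by (simp add: Int_Diff_Un Int_Diff_disjoint)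
  have unique: "l = ?l \<and> q' = ?r"
    if "Poly_Mapping.lookup p l \<noteq> 0" "Poly_Mapping.lookup q q' \<noteq> 0" "?k = l + q'" for l q'
  proof -
    have l: "Poly_Mapping.keys l \<subseteq> V" and q': "Poly_Mapping.keys q' \<subseteq> V'"
      using that p q by (auto simp: mpolys_over_def in_keys_iff)
    have "Poly_Mapping.lookup l v = Poly_Mapping.lookup ?l v" for v
    proof (cases "v \<in> V")
      case True
      then have "Poly_Mapping.lookup q' v = 0"
        using q' disj by (auto simp: in_keys_iff)
      then have "Poly_Mapping.lookup l v = Poly_Mapping.lookup ?k v"
        using that(3) by (simp add: lookup_add)
      then show ?thesis
        using True K by (simp add: lookup_sqfree_monom)
    next
      case False
      then show ?thesis
        using l K by (auto simp: in_keys_iff lookup_sqfree_monom)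
    qed
    then have "l = ?l"
      by (rule poly_mapping_eqI)
    then show ?thesis
      using split that(3) by simp
  qed
  have inner: "Sum_any (\<lambda>q'. Poly_Mapping.lookup q q' when ?k = ?l + q') = Poly_Mapping.lookup q ?r"
    by (simp add: split)
  have "Poly_Mapping.lookup (p * q) ?k =
      Sum_any (\<lambda>l. Poly_Mapping.lookup p l * Sum_any (\<lambda>q'. Poly_Mapping.lookup q q' when ?k = l + q'))"
    by (rule lookup_mult)
  also have "\<dots> = Sum_any (\<lambda>l. Poly_Mapping.lookup p l * Poly_Mapping.lookup q ?r when l = ?l)"
  proof (rule Sum_any.cong)
    fix l
    show "Poly_Mapping.lookup p l * Sum_any (\<lambda>q'. Poly_Mapping.lookup q q' when ?k = l + q') =
        (Poly_Mapping.lookup p l * Poly_Mapping.lookup q ?r when l = ?l)"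
    proof (cases "l = ?l")
      case True
      then show ?thesis
        using inner by simp
    next
      case False
      have "Sum_any (\<lambda>q'. Poly_Mapping.lookup q q' when ?k = l + q') = 0" if "Poly_Mapping.lookup p l \<noteq> 0"
      proof -
        have "(Poly_Mapping.lookup q q' when ?k = l + q') = 0" for q'
          using unique[OF that] False by (auto simp: when_def)
        then show ?thesis
          by (simp only: Sum_any.neutral)
      qed
      then show ?thesis
        using False by (cases "Poly_Mapping.lookup p l = 0") auto
    qed
  qed
  also have "\<dots> = Poly_Mapping.lookup p ?l * Poly_Mapping.lookup q ?r"
    by simp
  finally show ?thesis
    by (simp add: sqfree_coeff_def)
qed

lemma sqfree_coeff_mvar_mult:
  assumes "p \<in> mpolys_over V" "v \<notin> V" "finite K"
  shows "sqfree_coeff (mvar v * p) K = (if v \<in> K then sqfree_coeff p (K - {v}) else 0)"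
proof -
  have "sqfree_coeff (mvar v * p) K = sqfree_coeff (mvar v) (K \<inter> {v}) * sqfree_coeff p (K - {v})"
    using assms by (intro sqfree_coeff_mult[OF mpolys_over_mvar]) auto
  then show ?thesis
    using assms by (auto simp: sqfree_coeff_mvar)
qed

lemma formula_poly_mpolys_over: "formula_poly F \<in> mpolys_over (set (leaf_vars F))"
proof (induction F)
  case (FAdd F G)
  then show ?case
    by (auto intro!: mpolys_over_add intro: mpolys_over_mono)
next
  case (FMult F G)
  then show ?case
    by (auto intro!: mpolys_over_mult intro: mpolys_over_mono)
qed (auto simp: mpolys_over_mvar mpolys_over_mconst)

section \<open>Rank of matrices indexed by arbitrary types\<close>

text \<open>A sum of \<open>r\<close> outer products. No finiteness of the index types is required,
  and upper bounds follow by rule induction over any commutative ring; a field first enters with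
  \<open>homogeneous_system_nontrivial\<close>.\<close>

inductive rank_le :: "('s \<Rightarrow> 't \<Rightarrow> 'a::comm_ring_1) \<Rightarrow> nat \<Rightarrow> bool" where
  rank_le_zero: "rank_le (\<lambda>s t. 0) 0"
| rank_le_plus_outer: "rank_le M r \<Longrightarrow> rank_le (\<lambda>s t. M s t + a s * b t) (Suc r)"

lemma rank_le_mono:
  assumes "rank_le M r" "r \<le> r'"
  shows "rank_le M r'"
  using assms(2)
proof (induction rule: dec_induct)
  case base
  show ?case by (rule assms)
next
  case (step n)
  then show ?case
    using rank_le_plus_outer[of M n "\<lambda>_. 0" "\<lambda>_. 0"] by simp
qed

lemma rank_le_outer: "rank_le (\<lambda>s t. a s * b t) 1"
  using rank_le_plus_outer[OF rank_le_zero, of a b] by simp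

lemma rank_le_add:
  assumes "rank_le M r" "rank_le N r'"
  shows "rank_le (\<lambda>s t. M s t + N s t) (r + r')"
  using assms(2)
proof induction
  case rank_le_zero
  then show ?case using assms(1) by simp
next
  case (rank_le_plus_outer N r' a b)
  from rank_le.rank_le_plus_outer[OF this(2), of a b] show ?case
    by (simp add: add.assoc)
qed

lemma rank_le_scale_compose:
  assumes "rank_le M r"
  shows "rank_le (\<lambda>s t. x s * y t * M (f s) (g t)) r"
  using assms
proof induction
  case rank_le_zero
  then show ?case by (simp add: rank_le.rank_le_zero)
next
  case (rank_le_plus_outer M r a b)
  from rank_le.rank_le_plus_outer[OF this(2), of "\<lambda>s. x s * a (f s)" "\<lambda>t. y t * b (g t)"]
  show ?case by (simp add: algebra_simps)
qed

text \<open>Entrywise multiplication by an outer product merely scales rows and columns, so each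
  outer product of \<open>N\<close> contributes at most \<open>r\<close>.\<close>

lemma rank_le_mult:
  assumes "rank_le M r" "rank_le N r'"
  shows "rank_le (\<lambda>s t. M s t * N s t) (r * r')"
  using assms(2)
proof induction
  case rank_le_zero
  then show ?case by (simp add: rank_le.rank_le_zero)
next
  case (rank_le_plus_outer N r' a b)
  have "rank_le (\<lambda>s t. a s * b t * M s t) r"
    using rank_le_scale_compose[OF assms(1), of a b id id] by simp
  from rank_le_add[OF rank_le_plus_outer(2) this] show ?case
    by (simp add: algebra_simps)
qed

lemma rank_le_sum:
  assumes "finite I" "\<And>i. i \<in> I \<Longrightarrow> rank_le (M i) (r i)"
  shows "rank_le (\<lambda>s t. \<Sum>i\<in>I. M i s t) (\<Sum>i\<in>I. r i)"
  using assms
proof (induction I rule: finite_induct)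
  case empty
  then show ?case by (simp add: rank_le_zero)
next
  case (insert i I)
  then show ?case using rank_le_add[of "M i" "r i" "\<lambda>s t. \<Sum>i\<in>I. M i s t"] by simp
qed

lemma rank_le_imp_outer_sum:
  assumes "rank_le M r"
  shows "\<exists>a b. \<forall>s t. M s t = (\<Sum>i<r. a i s * b i t)"
  using assms
proof induction
  case rank_le_zero
  then show ?case by simp
next
  case (rank_le_plus_outer M r a b)
  then obtain a' b' where "\<forall>s t. M s t = (\<Sum>i<r. a' i s * b' i t)" by blast
  then have "\<forall>s t. M s t + a s * b t = (\<Sum>i<Suc r. (a'(r := a)) i s * (b'(r := b)) i t)"
    by simp
  then show ?case by blast
qed

text \<open>Gaussian elimination, by induction on the number of equations. Either the last equation
  is vacuous on \<open>I\<close>, or it is solved for an unknown \<open>u\<close> with nonzero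
  coefficient and substituted into the others.\<close>

lemma homogeneous_system_nontrivial:
  fixes b :: "nat \<Rightarrow> 't \<Rightarrow> 'a::field"
  assumes "finite I" "r < card I"
  shows "\<exists>x. (\<exists>t\<in>I. x t \<noteq> 0) \<and> (\<forall>i<r. (\<Sum>t\<in>I. b i t * x t) = 0)"
  using assms
proof (induction r arbitrary: I b)
  case 0
  then obtain t where "t \<in> I" by fastforce
  then show ?case by (intro exI[of _ "\<lambda>_. 1"]) auto
next
  case (Suc r)
  show ?case
  proof (cases "\<forall>t\<in>I. b r t = 0")
    case True
    obtain x where x: "\<exists>t\<in>I. x t \<noteq> 0" "\<forall>i<r. (\<Sum>t\<in>I. b i t * x t) = 0"
      using Suc.IH[of I b] Suc.prems by auto
    have "(\<Sum>t\<in>I. b r t * x t) = 0"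
      using True by simp
    then show ?thesis
      using x by (auto simp: less_Suc_eq)
  next
    case False
    then obtain u where u: "u \<in> I" "b r u \<noteq> 0" by blast
    define I' where "I' = I - {u}"
    define b' where "b' i t = b i t - b i u * b r t / b r u" for i t
    have I': "finite I'" "r < card I'"
      using Suc.prems u by (auto simp: I'_def)
    obtain x where x: "\<exists>t\<in>I'. x t \<noteq> 0" "\<forall>i<r. (\<Sum>t\<in>I'. b' i t * x t) = 0"
      using Suc.IH[OF I', of b'] by blast
    \<comment> \<open>The value that the eliminated equation \<open>r\<close> forces on the unknown
      \<open>u\<close>.\<close>
    define xu where "xu = - (\<Sum>t\<in>I'. b r t * x t) / b r u"
    define y where "y = x(u := xu)"
    have sum_y: "(\<Sum>t\<in>I. b i t * y t) = b i u * xu + (\<Sum>t\<in>I'. b i t * x t)" for i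
    proof -
      have "(\<Sum>t\<in>I. b i t * y t) = b i u * y u + (\<Sum>t\<in>I'. b i t * y t)"
        unfolding I'_def using Suc.prems u by (intro sum.remove) auto
      also have "(\<Sum>t\<in>I'. b i t * y t) = (\<Sum>t\<in>I'. b i t * x t)"
        by (rule sum.cong) (auto simp: y_def I'_def)
      finally show ?thesis by (simp add: y_def)
    qed
    have b_eq: "(\<Sum>t\<in>I'. b i t * x t) =
        (\<Sum>t\<in>I'. b' i t * x t) + b i u / b r u * (\<Sum>t\<in>I'. b r t * x t)" for i
    proof -
      have "(\<Sum>t\<in>I'. b i t * x t) = (\<Sum>t\<in>I'. b' i t * x t + b i u / b r u * (b r t * x t))"
        by (rule sum.cong) (simp_all add: b'_def algebra_simps)
      then show ?thesis
        by (simp only: sum.distrib sum_distrib_left)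
    qed
    have "(\<Sum>t\<in>I. b i t * y t) = 0" if "i < Suc r" for i
    proof (cases "i = r")
      case True
      then show ?thesis
        using u by (simp add: sum_y xu_def)
    next
      case False
      then show ?thesis
        using x that by (simp add: sum_y b_eq[of i] xu_def)
    qed
    moreover have "\<exists>t\<in>I. y t \<noteq> 0"
      using x by (auto simp: y_def I'_def)
    ultimately show ?thesis by blast
  qed
qed

lemma rank_le_permutation_matrix:
  fixes M :: "'s \<Rightarrow> 't \<Rightarrow> 'a::field"
  assumes rank: "rank_le M r" and fin: "finite I" and inj: "inj_on \<sigma> I"
    and M: "\<And>s s'. s \<in> I \<Longrightarrow> s' \<in> I \<Longrightarrow> M s (\<sigma> s') = (if s = s' then 1 else 0)"
  shows "card I \<le> r"
proof (rule ccontr)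
  assume "\<not> card I \<le> r"
  obtain a b where ab: "\<And>s t. M s t = (\<Sum>i<r. a i s * b i t)"
    using rank_le_imp_outer_sum[OF rank] by blast
  obtain x where x: "\<exists>t\<in>I. x t \<noteq> 0" "\<And>i. i < r \<Longrightarrow> (\<Sum>t\<in>I. b i (\<sigma> t) * x t) = 0"
    using homogeneous_system_nontrivial[of I r "\<lambda>i t. b i (\<sigma> t)"] fin \<open>\<not> card I \<le> r\<close> by auto
  have "x s = 0" if "s \<in> I" for s
  proof -
    have "x s = (\<Sum>t\<in>I. M s (\<sigma> t) * x t)"
      using that fin by (simp add: M if_distrib[of "\<lambda>z. z * _"] cong: if_cong)
    also have "\<dots> = (\<Sum>t\<in>I. \<Sum>i<r. a i s * (b i (\<sigma> t) * x t))"
      by (simp add: ab sum_distrib_right mult.assoc)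
    also have "\<dots> = (\<Sum>i<r. a i s * (\<Sum>t\<in>I. b i (\<sigma> t) * x t))"
      by (subst sum.swap) (simp add: sum_distrib_left)
    also have "\<dots> = 0"
      by (simp add: x)
    finally show ?thesis .
  qed
  then show False
    using x by blast
qed

section \<open>Rank of the coefficient matrix of a read-once polynomial\<close>

text \<open>Intersecting with \<open>A\<close> and \<open>B\<close> makes every pair of sets a legal
  index, so rows and columns can be restricted to \<open>V\<close> or its complement without side
  conditions.\<close>

definition coeff_matrix :: "'v set \<Rightarrow> 'v set \<Rightarrow> ('v, 'a::comm_ring_1) mpoly \<Rightarrow> 'v set \<Rightarrow> 'v set \<Rightarrow> 'v set \<Rightarrow> 'a"
  where "coeff_matrix A B p m S T = sqfree_coeff p (m \<union> S \<inter> A \<union> T \<inter> B)"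

text \<open>The variables outside \<open>A \<union> B\<close> are parameters; the bound is uniform in the parameter
  monomial \<open>m\<close> and in the constant \<open>c\<close> added to \<open>d\<close> times the polynomial.\<close>

definition affine_rank_le :: "'v set \<Rightarrow> 'v set \<Rightarrow> ('v, 'a::comm_ring_1) mpoly \<Rightarrow> nat \<Rightarrow> bool" where
  "affine_rank_le A B p r \<longleftrightarrow> (\<forall>m c d. finite m \<longrightarrow> m \<inter> (A \<union> B) = {} \<longrightarrow>
     rank_le (\<lambda>S T. d * coeff_matrix A B p m S T + of_bool (S \<inter> A = {}) * of_bool (T \<inter> B = {}) * c) r)"

lemma affine_rank_leI:
  assumes "\<And>m c d. finite m \<Longrightarrow> m \<inter> (A \<union> B) = {} \<Longrightarrow>
    rank_le (\<lambda>S T. d * coeff_matrix A B p m S T + of_bool (S \<inter> A = {}) * of_bool (T \<inter> B = {}) * c) r"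
  shows "affine_rank_le A B p r"
  using assms by (simp add: affine_rank_le_def)

lemma affine_rank_leD:
  assumes "affine_rank_le A B p r" "finite m" "m \<inter> (A \<union> B) = {}"
  shows "rank_le (\<lambda>S T. d * coeff_matrix A B p m S T + of_bool (S \<inter> A = {}) * of_bool (T \<inter> B = {}) * c) r"
  using assms by (simp add: affine_rank_le_def)

lemma affine_rank_le_mono: "affine_rank_le A B p r \<Longrightarrow> r \<le> r' \<Longrightarrow> affine_rank_le A B p r'"
  by (auto simp: affine_rank_le_def intro: rank_le_mono)

section \<open>Effect of the formula operations on the affine rank\<close>

context
  fixes A B :: "'v set"
  assumes fin: "finite A" "finite B" and disj: "A \<inter> B = {}"
begin

lemma coeff_matrix_outside:
  assumes "p \<in> mpolys_over V" "finite m" "\<not> m \<union> S \<inter> A \<union> T \<inter> B \<subseteq> V"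
  shows "coeff_matrix A B p m S T = 0"
  unfolding coeff_matrix_def using fin assms by (intro sqfree_coeff_outside[OF assms(1)]) auto

text \<open>Only the column \<open>T \<inter> B = {}\<close> is nonzero, and the added constant lies
  in that same column, so it is free.\<close>

lemma affine_rank_le_rows_only:
  assumes p: "p \<in> mpolys_over V" and V: "V \<inter> B = {}"
  shows "affine_rank_le A B p 1"
proof (rule affine_rank_leI)
  fix m c d assume m: "finite m" "m \<inter> (A \<union> B) = {}"
  have eq: "(\<lambda>S T. d * coeff_matrix A B p m S T + of_bool (S \<inter> A = {}) * of_bool (T \<inter> B = {}) * c) =
     (\<lambda>S T. (d * coeff_matrix A B p m S {} + of_bool (S \<inter> A = {}) * c) * of_bool (T \<inter> B = {}))"
  proof (intro ext)
    fix S T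
    show "d * coeff_matrix A B p m S T + of_bool (S \<inter> A = {}) * of_bool (T \<inter> B = {}) * c =
        (d * coeff_matrix A B p m S {} + of_bool (S \<inter> A = {}) * c) * of_bool (T \<inter> B = {})"
    proof (cases "T \<inter> B = {}")
      case True
      then show ?thesis by (simp add: coeff_matrix_def)
    next
      case False
      then have "coeff_matrix A B p m S T = 0"
        using V by (intro coeff_matrix_outside[OF p m(1)]) auto
      then show ?thesis using False by simp
    qed
  qed
  show "rank_le (\<lambda>S T. d * coeff_matrix A B p m S T +
      of_bool (S \<inter> A = {}) * of_bool (T \<inter> B = {}) * c) 1"
    unfolding eq by (rule rank_le_outer)
qed

lemma affine_rank_le_columns_only:
  assumes p: "p \<in> mpolys_over V" and V: "V \<inter> A = {}"
  shows "affine_rank_le A B p 1"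
proof (rule affine_rank_leI)
  fix m c d assume m: "finite m" "m \<inter> (A \<union> B) = {}"
  have eq: "(\<lambda>S T. d * coeff_matrix A B p m S T + of_bool (S \<inter> A = {}) * of_bool (T \<inter> B = {}) * c) =
     (\<lambda>S T. of_bool (S \<inter> A = {}) * (d * coeff_matrix A B p m {} T + of_bool (T \<inter> B = {}) * c))"
  proof (intro ext)
    fix S T
    show "d * coeff_matrix A B p m S T + of_bool (S \<inter> A = {}) * of_bool (T \<inter> B = {}) * c =
        of_bool (S \<inter> A = {}) * (d * coeff_matrix A B p m {} T + of_bool (T \<inter> B = {}) * c)"
    proof (cases "S \<inter> A = {}")
      case True
      then show ?thesis by (simp add: coeff_matrix_def)
    next
      case False
      then have "coeff_matrix A B p m S T = 0"
        using V by (intro coeff_matrix_outside[OF p m(1)]) auto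
      then show ?thesis using False by simp
    qed
  qed
  show "rank_le (\<lambda>S T. d * coeff_matrix A B p m S T +
      of_bool (S \<inter> A = {}) * of_bool (T \<inter> B = {}) * c) 1"
    unfolding eq by (rule rank_le_outer)
qed

text \<open>At most two kinds of row are nonzero, \<open>S \<inter> A = {}\<close> and
  \<open>S \<inter> A = {x}\<close>; the constant falls into the first.\<close>

lemma affine_rank_le_one_row_variable:
  assumes p: "p \<in> mpolys_over V" and V: "V \<inter> A = {x}"
  shows "affine_rank_le A B p 2"
proof (rule affine_rank_leI)
  fix m c d assume m: "finite m" "m \<inter> (A \<union> B) = {}"
  let ?M = "\<lambda>S T. d * coeff_matrix A B p m S T + of_bool (S \<inter> A = {}) * of_bool (T \<inter> B = {}) * c"
  have eq: "?M = (\<lambda>S T. of_bool (S \<inter> A = {}) * (d * coeff_matrix A B p m {} T + of_bool (T \<inter> B = {}) * c) +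
     of_bool (S \<inter> A = {x}) * (d * coeff_matrix A B p m {x} T))"
  proof (intro ext)
    fix S T
    have "S \<inter> A \<subseteq> {x}" if "S \<inter> A \<subseteq> V"
      using V that by auto
    then consider "S \<inter> A = {}" | "S \<inter> A = {x}" | "\<not> S \<inter> A \<subseteq> V"
      using subset_singletonD by metis
    then show "?M S T = of_bool (S \<inter> A = {}) *
        (d * coeff_matrix A B p m {} T + of_bool (T \<inter> B = {}) * c) +
        of_bool (S \<inter> A = {x}) * (d * coeff_matrix A B p m {x} T)"
    proof cases
      case 3
      then have "coeff_matrix A B p m S T = 0"
        by (intro coeff_matrix_outside[OF p m(1)]) blast
      moreover have "S \<inter> A \<noteq> {}" "S \<inter> A \<noteq> {x}"
        using 3 V by auto
      ultimately show ?thesis by simp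
    next
      case 2
      moreover have "x \<in> A" using V by auto
      ultimately show ?thesis by (simp add: coeff_matrix_def)
    qed (simp add: coeff_matrix_def)
  qed
  show "rank_le ?M 2"
    unfolding eq
    using rank_le_add[OF
        rank_le_outer[of "\<lambda>S. of_bool (S \<inter> A = {})"
          "\<lambda>T. d * coeff_matrix A B p m {} T + of_bool (T \<inter> B = {}) * c"]
        rank_le_outer[of "\<lambda>S. of_bool (S \<inter> A = {x})" "\<lambda>T. d * coeff_matrix A B p m {x} T"]]
    by (simp only: one_add_one)
qed

lemma affine_rank_le_add:
  assumes "affine_rank_le A B p r" "affine_rank_le A B q r'"
  shows "affine_rank_le A B (p + q) (r + r')"
proof (rule affine_rank_leI)
  fix m c d assume m: "finite m" "m \<inter> (A \<union> B) = {}"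
  \<comment> \<open>The whole constant is charged to \<open>q\<close>; the summand \<open>p\<close>
    gets the constant 0.\<close>
  have "rank_le (\<lambda>S T. (d * coeff_matrix A B p m S T + of_bool (S \<inter> A = {}) * of_bool (T \<inter> B = {}) * 0) +
     (d * coeff_matrix A B q m S T + of_bool (S \<inter> A = {}) * of_bool (T \<inter> B = {}) * c)) (r + r')"
    by (intro rank_le_add affine_rank_leD[OF _ m] assms)
  then show "rank_le (\<lambda>S T. d * coeff_matrix A B (p + q) m S T +
      of_bool (S \<inter> A = {}) * of_bool (T \<inter> B = {}) * c) (r + r')"
    by (simp add: coeff_matrix_def algebra_simps)
qed

lemma coeff_matrix_mult:
  assumes p: "p \<in> mpolys_over V" and q: "q \<in> mpolys_over V'" and VV': "V \<inter> V' = {}" and m: "finite m"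
  shows "coeff_matrix A B (p * q) m S T =
    coeff_matrix A B p (m \<inter> V) (S \<inter> V) (T \<inter> V) * coeff_matrix A B q (m - V) (S - V) (T - V)"
proof -
  have "(m \<union> S \<inter> A \<union> T \<inter> B) \<inter> V = m \<inter> V \<union> S \<inter> V \<inter> A \<union> T \<inter> V \<inter> B"
    "m \<union> S \<inter> A \<union> T \<inter> B - V = m - V \<union> (S - V) \<inter> A \<union> (T - V) \<inter> B"
    by auto
  then show ?thesis
    unfolding coeff_matrix_def using sqfree_coeff_mult[OF p q VV'] fin m by simp
qed

text \<open>After relabelling indices by intersection with \<open>V\<close> and difference from
  \<open>V\<close>, the matrix of the product is an entrywise product. The scalar \<open>d\<close>
  is absorbed into the first factor, but the constant cannot be distributed over a product and costs
  one more outer product.\<close>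

lemma affine_rank_le_mult:
  assumes p: "p \<in> mpolys_over V" and q: "q \<in> mpolys_over V'" and VV': "V \<inter> V' = {}"
    and "affine_rank_le A B p r" "affine_rank_le A B q r'"
  shows "affine_rank_le A B (p * q) (r * r' + 1)"
proof (rule affine_rank_leI)
  fix m c d assume m: "finite m" "m \<inter> (A \<union> B) = {}"
  have "rank_le (\<lambda>S T. d * coeff_matrix A B p (m \<inter> V) S T) r"
    using affine_rank_leD[OF assms(4), of "m \<inter> V" d 0] m by auto
  from rank_le_scale_compose[OF this, of "\<lambda>_. 1" "\<lambda>_. 1" "\<lambda>S. S \<inter> V" "\<lambda>T. T \<inter> V"]
  have p': "rank_le (\<lambda>S T. d * coeff_matrix A B p (m \<inter> V) (S \<inter> V) (T \<inter> V)) r"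
    by simp
  have "rank_le (\<lambda>S T. 1 * coeff_matrix A B q (m - V) S T + of_bool (S \<inter> A = {}) * of_bool (T \<inter> B = {}) * 0) r'"
    using m by (intro affine_rank_leD[OF assms(5)]) auto
  from rank_le_scale_compose[OF this, of "\<lambda>_. 1" "\<lambda>_. 1" "\<lambda>S. S - V" "\<lambda>T. T - V"]
  have q': "rank_le (\<lambda>S T. coeff_matrix A B q (m - V) (S - V) (T - V)) r'"
    by simp
  from rank_le_add[OF rank_le_mult[OF p' q']
      rank_le_outer[of "\<lambda>S. of_bool (S \<inter> A = {})" "\<lambda>T. of_bool (T \<inter> B = {}) * c"]]
  show "rank_le (\<lambda>S T. d * coeff_matrix A B (p * q) m S T +
      of_bool (S \<inter> A = {}) * of_bool (T \<inter> B = {}) * c) (r * r' + 1)"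
    by (simp add: coeff_matrix_mult[OF p q VV' m(1)] mult.assoc)
qed

text \<open>A polynomial in parameters only affects the entry with empty row and column, hence
  shifts \<open>c\<close>. This is why the affine rank quantifies over \<open>c\<close>.\<close>

lemma affine_rank_le_add_parameter:
  assumes q: "q \<in> mpolys_over V" and V: "V \<inter> (A \<union> B) = {}" and p: "affine_rank_le A B p r"
  shows "affine_rank_le A B (p + q) r"
proof (rule affine_rank_leI)
  fix m c d assume m: "finite m" "m \<inter> (A \<union> B) = {}"
  have q_eq: "coeff_matrix A B q m S T = of_bool (S \<inter> A = {}) * of_bool (T \<inter> B = {}) * sqfree_coeff q m" for S T
  proof (cases "S \<inter> A = {} \<and> T \<inter> B = {}")
    case True
    then show ?thesis by (simp add: coeff_matrix_def)
  next
    case False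
    then have "coeff_matrix A B q m S T = 0"
      using V by (intro coeff_matrix_outside[OF q m(1)]) auto
    then show ?thesis
      using False by auto
  qed
  have "coeff_matrix A B (p + q) m S T = coeff_matrix A B p m S T + coeff_matrix A B q m S T" for S T
    by (simp add: coeff_matrix_def)
  then have "d * coeff_matrix A B (p + q) m S T + of_bool (S \<inter> A = {}) * of_bool (T \<inter> B = {}) * c =
      d * coeff_matrix A B p m S T + of_bool (S \<inter> A = {}) * of_bool (T \<inter> B = {}) * (d * sqfree_coeff q m + c)"
    for S T
    by (simp add: q_eq algebra_simps)
  then show "rank_le (\<lambda>S T. d * coeff_matrix A B (p + q) m S T +
      of_bool (S \<inter> A = {}) * of_bool (T \<inter> B = {}) * c) r"
    using affine_rank_leD[OF p m] by simp
qed

text \<open>Multiplication by such a polynomial replaces \<open>m\<close> by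
  \<open>m \<inter> V\<close> and rescales the matrix by one coefficient, which explains the
  quantification over \<open>m\<close> and \<open>d\<close>.\<close>

lemma affine_rank_le_mult_parameter:
  assumes p: "p \<in> mpolys_over V" and q: "q \<in> mpolys_over V'" and VV': "V \<inter> V' = {}"
    and V': "V' \<inter> (A \<union> B) = {}" and rank: "affine_rank_le A B p r"
  shows "affine_rank_le A B (p * q) r"
proof (rule affine_rank_leI)
  fix m c d assume m: "finite m" "m \<inter> (A \<union> B) = {}"
  let ?d = "sqfree_coeff q (m - V)"
  have "coeff_matrix A B (p * q) m S T = ?d * coeff_matrix A B p (m \<inter> V) S T" for S T
  proof (cases "S \<inter> A \<union> T \<inter> B \<subseteq> V")
    case True
    then have "(S - V) \<inter> A = {}" "(T - V) \<inter> B = {}" "S \<inter> V \<inter> A = S \<inter> A" "T \<inter> V \<inter> B = T \<inter> B"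
      by auto
    then show ?thesis
      unfolding coeff_matrix_mult[OF p q VV' m(1)] by (simp add: coeff_matrix_def)
  next
    case False
    then have "coeff_matrix A B q (m - V) (S - V) (T - V) = 0"
      using V' m by (intro coeff_matrix_outside[OF q]) auto
    moreover have "coeff_matrix A B p (m \<inter> V) S T = 0"
      using False m by (intro coeff_matrix_outside[OF p]) auto
    ultimately show ?thesis
      by (simp add: coeff_matrix_mult[OF p q VV' m(1)])
  qed
  then show "rank_le (\<lambda>S T. d * coeff_matrix A B (p * q) m S T +
      of_bool (S \<inter> A = {}) * of_bool (T \<inter> B = {}) * c) r"
    using affine_rank_leD[OF rank, of "m \<inter> V" "d * ?d" c] m by (auto simp: mult.assoc)
qed

end

text \<open>The weight of a formula is the product of 113/80 for each single leaf and, for each pair of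
  leaves that meet first, 117/50 if \<open>A\<close> separates the pair and 331/200 otherwise. The constants
  satisfy \<open>(113/80)\<^sup>2 < 2\<close> and \<open>117/50 + 331/200 < 4\<close>, which makes the average weight decay
  relative to \<open>2^n\<close>, while leaving enough room for the slack 3/10 in \<open>tame\<close> to absorb the
  \<open>+ 1\<close> of the recursion \<open>r r' + 1\<close>.\<close>

definition node_weight :: "'v set \<Rightarrow> 'v set \<Rightarrow> 'v set \<Rightarrow> real \<Rightarrow> real" where
  "node_weight Q A V w =
    (if card (V \<inter> Q) = 2 then (if card (V \<inter> A) = 1 then 117/50 else 331/200) else w)"

primrec weight :: "'v set \<Rightarrow> 'v set \<Rightarrow> ('v, 'a) formula \<Rightarrow> real" where
  "weight Q A (FVar v) = (if v \<in> Q then 113/80 else 1)"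
| "weight Q A (FConst c) = 1"
| "weight Q A (FAdd F G) =
    node_weight Q A (set (leaf_vars F) \<union> set (leaf_vars G)) (weight Q A F * weight Q A G)"
| "weight Q A (FMult F G) =
    node_weight Q A (set (leaf_vars F) \<union> set (leaf_vars G)) (weight Q A F * weight Q A G)"

text \<open>The isolated values belong to a separated pair, an unseparated pair, and an unseparated
  pair with one more leaf. They have the slack but lie below the threshold 243/100. A further leaf
  preserves the slack if \<open>1 \<le> 33/80 * w\<close>, that is, \<open>w \<ge> 80/33\<close>,
  which 243/100 just exceeds. The values 117/50 and 331/200 are barely large enough that rank 3 has
  slack 3/10 after one leaf, respectively two leaves, are added to the pair.\<close>

definition tame :: "nat \<Rightarrow> real \<Rightarrow> bool" where
  "tame r w \<longleftrightarrow> r = 2 \<and> w = 117/50 \<or> r = 1 \<and> w = 331/200 \<or> r = 2 \<and> w = 113/80 * (331/200) \<or>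
     r \<ge> 1 \<and> w \<ge> 243/100 \<and> real r \<le> w - 3/10"

lemma tame_bigI: "r \<ge> 1 \<Longrightarrow> w \<ge> 243/100 \<Longrightarrow> real r \<le> w - 3/10 \<Longrightarrow> tame r w"
  by (simp add: tame_def)

lemma tame_cases:
  assumes "tame r w"
  obtains "r = 2" "w = 117/50" | "r = 1" "w = 331/200" | "r = 2" "w = 37403/16000"
    | "r \<ge> 1" "w \<ge> 243/100" "real r \<le> w - 3/10"
  using assms unfolding tame_def by fastforce

lemma tame_leaf:
  assumes "tame r w"
  shows "tame (r + 1) (113/80 * w)"
  using assms
proof (cases rule: tame_cases)
  case 2
  then show ?thesis by (simp add: tame_def)
qed (auto intro!: tame_bigI)

lemma tame_mult_small: "tame (r * r' + 1) (w * w')"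
    if r: "r = 2 \<and> w = 117/50 \<or> r = 1 \<and> w = 331/200 \<or> r = 2 \<and> w = 37403/16000" and t: "tame r' w'"
  using r
proof (elim disjE conjE)
  assume [simp]: "r = 2" "w = 117/50"
  from t show ?thesis by (cases rule: tame_cases) (simp_all add: tame_bigI)
next
  assume [simp]: "r = 1" "w = 331/200"
  from t show ?thesis by (cases rule: tame_cases) (simp_all add: tame_bigI)
next
  assume [simp]: "r = 2" "w = 37403/16000"
  from t show ?thesis by (cases rule: tame_cases) (simp_all add: tame_bigI)
qed

lemma tame_mult:
  assumes t: "tame r w" and t': "tame r' w'"
  shows "tame (r * r' + 1) (w * w')"
  using t
proof (cases rule: tame_cases)
  case big: 4
  from t' show ?thesis
  proof (cases rule: tame_cases)
    case 4
    have "real r * real r' \<le> (w - 3/10) * (w' - 3/10)"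
      using big 4 by (intro mult_mono) auto
    \<comment> \<open>Expanding the product, the claim amounts to
      \<open>w + w' \<ge> 139/30\<close>; the two thresholds give 243/50.\<close>
    then have "real (r * r' + 1) \<le> w * w' - 3/10"
      using big 4 by (simp add: algebra_simps)
    moreover have "243/100 * (243/100) \<le> w * w'"
      using big 4 by (intro mult_mono) auto
    ultimately show ?thesis by (intro tame_bigI) auto
  qed (use tame_mult_small[of r' w' r w] t in \<open>simp_all add: mult.commute\<close>)
qed (use tame_mult_small[of r w r' w'] t' in simp_all)

lemma tame_rank_le_weight: "tame r w \<Longrightarrow> real r \<le> w"
  by (erule tame_cases) auto

section \<open>Comparison of rank and weight along a formula\<close>

context
  fixes Q A B :: "'v set"
  assumes fin: "finite A" "finite B" and disj: "A \<inter> B = {}" and Q: "Q = A \<union> B"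
begin

text \<open>For positive ranks \<open>(r - 1) * (r' - 1) \<ge> 0\<close> gives
  \<open>r + r' \<le> r * r' + 1\<close>, so a single recursion serves both operations.\<close>

lemma affine_rank_le_node:
  assumes op: "f = p + q \<or> f = p * q"
    and "p \<in> mpolys_over V" "q \<in> mpolys_over V'" "V \<inter> V' = {}"
    and rank: "affine_rank_le A B p r" "affine_rank_le A B q r'" and "r \<ge> 1" "r' \<ge> 1"
  shows "affine_rank_le A B f (r * r' + 1)"
  using op
proof
  assume "f = p + q"
  moreover have "r + r' \<le> r * r' + 1"
    using assms(7,8) by (cases r; cases r') auto
  ultimately show ?thesis
    using affine_rank_le_add[OF fin disj rank] affine_rank_le_mono by blast
next
  assume "f = p * q"
  then show ?thesis
    using affine_rank_le_mult[OF fin disj assms(2-6)] by simp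
qed

lemma affine_rank_le_parameter_node:
  assumes op: "f = p + q \<or> f = p * q"
    and "p \<in> mpolys_over V" "q \<in> mpolys_over V'" "V \<inter> V' = {}" "V' \<inter> Q = {}"
    and rank: "affine_rank_le A B p r"
  shows "affine_rank_le A B f r"
  using op affine_rank_le_add_parameter[OF fin disj assms(3) _ rank]
    affine_rank_le_mult_parameter[OF fin disj assms(2-4) _ rank] assms(5) Q by blast

lemma affine_rank_le_one_variable:
  assumes p: "p \<in> mpolys_over V" and V: "card (V \<inter> Q) \<le> 1"
  shows "affine_rank_le A B p 1"
proof -
  have "V \<inter> A = {} \<or> V \<inter> B = {}"
  proof (rule ccontr)
    assume "\<not> (V \<inter> A = {} \<or> V \<inter> B = {})"
    then obtain x y where "x \<in> V \<inter> A" "y \<in> V \<inter> B" by blast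
    then have "{x, y} \<subseteq> V \<inter> Q" "x \<noteq> y" using Q disj by auto
    then show False
      using V card_mono[of "V \<inter> Q" "{x, y}"] fin Q by auto
  qed
  then show ?thesis
    using affine_rank_le_rows_only[OF fin disj p] affine_rank_le_columns_only[OF fin disj p] by blast
qed

text \<open>Here \<open>w\<close> is arbitrary: \<open>node_weight\<close> discards it at a pair, so
  the recursion starts afresh with a rank read off directly from how \<open>A\<close> meets the
  pair.\<close>

lemma affine_rank_le_two_variables:
  assumes p: "p \<in> mpolys_over V" and V: "card (V \<inter> Q) = 2"
  shows "\<exists>r. affine_rank_le A B p r \<and> tame r (node_weight Q A V w)"
proof -
  have card: "card (V \<inter> Q) = card (V \<inter> A) + card (V \<inter> B)"
    unfolding Q Int_Un_distrib using fin disj by (intro card_Un_disjoint) auto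
  then consider "card (V \<inter> A) = 1" | "card (V \<inter> A) = 0" | "card (V \<inter> A) = 2" "card (V \<inter> B) = 0"
    using V by linarith
  then show ?thesis
  proof cases
    case 1
    then obtain x where "V \<inter> A = {x}" by (auto simp: card_1_singleton_iff)
    from affine_rank_le_one_row_variable[OF fin disj p this] 1 V show ?thesis
      by (auto simp: node_weight_def tame_def)
  next
    case 2
    then have "V \<inter> A = {}" using fin by simp
    from affine_rank_le_columns_only[OF fin disj p this] 2 V show ?thesis
      by (auto simp: node_weight_def tame_def)
  next
    case 3
    then have "V \<inter> B = {}" using fin by simp
    from affine_rank_le_rows_only[OF fin disj p this] 3 V show ?thesis
      by (auto simp: node_weight_def tame_def)
  qed
qed

text \<open>Rank 1 with weight 1 or 113/80 is not tame, so tameness can only start at two leaves in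
  \<open>Q\<close>. Below that the invariant is the exact weight, and the rank is 1 by
  \<open>affine_rank_le_one_variable\<close>. A child without leaves in \<open>Q\<close> is a
  parameter and leaves the rank unchanged.\<close>

lemma affine_rank_le_weight_node:
  assumes op: "f = formula_poly F + formula_poly G \<or> f = formula_poly F * formula_poly G"
    and VF: "VF = set (leaf_vars F)" and VG: "VG = set (leaf_vars G)" and disjV: "VF \<inter> VG = {}"
    and F0: "card (VF \<inter> Q) = 0 \<Longrightarrow> weight Q A F = 1"
    and F1: "card (VF \<inter> Q) = 1 \<Longrightarrow> weight Q A F = 113/80"
    and F2: "card (VF \<inter> Q) \<ge> 2 \<Longrightarrow> \<exists>r. affine_rank_le A B (formula_poly F) r \<and> tame r (weight Q A F)"
    and G0: "card (VG \<inter> Q) = 0 \<Longrightarrow> weight Q A G = 1"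
    and G1: "card (VG \<inter> Q) = 1 \<Longrightarrow> weight Q A G = 113/80"
    and G2: "card (VG \<inter> Q) \<ge> 2 \<Longrightarrow> \<exists>r. affine_rank_le A B (formula_poly G) r \<and> tame r (weight Q A G)"
  defines "w \<equiv> node_weight Q A (VF \<union> VG) (weight Q A F * weight Q A G)"
  shows "(card ((VF \<union> VG) \<inter> Q) = 0 \<longrightarrow> w = 1) \<and> (card ((VF \<union> VG) \<inter> Q) = 1 \<longrightarrow> w = 113/80) \<and>
    (card ((VF \<union> VG) \<inter> Q) \<ge> 2 \<longrightarrow> (\<exists>r. affine_rank_le A B f r \<and> tame r w))"
proof -
  let ?p = "formula_poly F" and ?q = "formula_poly G"
  have p: "?p \<in> mpolys_over VF" and q: "?q \<in> mpolys_over VG"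
    by (simp_all add: VF VG formula_poly_mpolys_over)
  have op': "f = ?q + ?p \<or> f = ?q * ?p" and disjV': "VG \<inter> VF = {}"
    using op disjV by (auto simp: algebra_simps)
  have finQ: "finite Q" using fin Q by simp
  have card: "card ((VF \<union> VG) \<inter> Q) = card (VF \<inter> Q) + card (VG \<inter> Q)"
    unfolding Int_Un_distrib2 using finQ disjV by (intro card_Un_disjoint) auto
  have tame_pos: "tame r w \<Longrightarrow> r \<ge> 1" for r w
    by (auto simp: tame_def)
  have big: "\<exists>r. affine_rank_le A B f r \<and> tame r w" if ge2: "card ((VF \<union> VG) \<inter> Q) \<ge> 2"
  proof (cases "card ((VF \<union> VG) \<inter> Q) = 2")
    case True
    have "f \<in> mpolys_over (VF \<union> VG)"
      using op mpolys_over_mono[OF p Un_upper1[of VF VG]] mpolys_over_mono[OF q Un_upper2[of VG VF]]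
      by (auto intro: mpolys_over_add mpolys_over_mult)
    then show ?thesis
      unfolding w_def using True by (rule affine_rank_le_two_variables)
  next
    case False
    then have w: "w = weight Q A F * weight Q A G"
      by (simp add: w_def node_weight_def)
    consider "card (VF \<inter> Q) = 0" "card (VG \<inter> Q) \<ge> 2" | "card (VG \<inter> Q) = 0" "card (VF \<inter> Q) \<ge> 2"
      | "card (VF \<inter> Q) = 1" "card (VG \<inter> Q) \<ge> 2" | "card (VG \<inter> Q) = 1" "card (VF \<inter> Q) \<ge> 2"
      | "card (VF \<inter> Q) \<ge> 2" "card (VG \<inter> Q) \<ge> 2"
      using False ge2 card by linarith
    then show ?thesis
    proof cases
      case 1
      then have "VF \<inter> Q = {}" using finQ by simp
      obtain r where r: "affine_rank_le A B ?q r" "tame r (weight Q A G)"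
        using G2 1 by blast
      have "affine_rank_le A B f r"
        by (rule affine_rank_le_parameter_node[OF op' q p disjV' \<open>VF \<inter> Q = {}\<close> r(1)])
      then show ?thesis using r F0 1 by (auto simp: w)
    next
      case 2
      then have "VG \<inter> Q = {}" using finQ by simp
      obtain r where r: "affine_rank_le A B ?p r" "tame r (weight Q A F)"
        using F2 2 by blast
      have "affine_rank_le A B f r"
        by (rule affine_rank_le_parameter_node[OF op p q disjV \<open>VG \<inter> Q = {}\<close> r(1)])
      then show ?thesis using r G0 2 by (auto simp: w)
    next
      case 3
      obtain r where r: "affine_rank_le A B ?q r" "tame r (weight Q A G)"
        using G2 3 by blast
      have "affine_rank_le A B f (r * 1 + 1)"
        using affine_rank_le_one_variable[OF p] r tame_pos 3
        by (intro affine_rank_le_node[OF op' q p disjV']) auto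
      moreover have "tame (r + 1) w"
        unfolding w F1[OF 3(1)] by (rule tame_leaf[OF r(2)])
      ultimately show ?thesis by auto
    next
      case 4
      obtain r where r: "affine_rank_le A B ?p r" "tame r (weight Q A F)"
        using F2 4 by blast
      have "affine_rank_le A B f (r * 1 + 1)"
        using affine_rank_le_one_variable[OF q] r tame_pos 4
        by (intro affine_rank_le_node[OF op p q disjV]) auto
      moreover have "tame (r + 1) w"
        unfolding w G1[OF 4(1)] mult.commute[of _ "113/80"] by (rule tame_leaf[OF r(2)])
      ultimately show ?thesis by auto
    next
      case 5
      obtain r r' where r: "affine_rank_le A B ?p r" "tame r (weight Q A F)"
        and r': "affine_rank_le A B ?q r'" "tame r' (weight Q A G)"
        using F2 G2 5 by blast
      have "affine_rank_le A B f (r * r' + 1)"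
        using r r' tame_pos by (intro affine_rank_le_node[OF op p q disjV]) auto
      moreover have "tame (r * r' + 1) w"
        unfolding w by (rule tame_mult[OF r(2) r'(2)])
      ultimately show ?thesis by blast
    qed
  qed
  have "w = 1" if "card ((VF \<union> VG) \<inter> Q) = 0"
    using that card F0 G0 by (simp add: w_def node_weight_def)
  moreover have "w = 113/80" if "card ((VF \<union> VG) \<inter> Q) = 1"
  proof -
    have "card (VF \<inter> Q) = 0 \<and> card (VG \<inter> Q) = 1 \<or> card (VF \<inter> Q) = 1 \<and> card (VG \<inter> Q) = 0"
      using that card by linarith
    then show ?thesis
      using that F0 F1 G0 G1 by (auto simp: w_def node_weight_def)
  qed
  ultimately show ?thesis
    using big by blast
qed

lemma affine_rank_le_weight_cases:
  fixes F :: "('v, 'a::field) formula"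
  assumes "read_once_formula F"
  shows "(card (set (leaf_vars F) \<inter> Q) = 0 \<longrightarrow> weight Q A F = 1) \<and>
    (card (set (leaf_vars F) \<inter> Q) = 1 \<longrightarrow> weight Q A F = 113/80) \<and>
    (card (set (leaf_vars F) \<inter> Q) \<ge> 2 \<longrightarrow>
      (\<exists>r. affine_rank_le A B (formula_poly F) r \<and> tame r (weight Q A F)))"
  using assms
proof (induction F)
  case (FVar v)
  have "card ({v} \<inter> Q) = (if v \<in> Q then 1 else 0)" by simp
  then show ?case by auto
next
  case (FConst c)
  then show ?case by simp
next
  case (FAdd F G)
  have "set (leaf_vars F) \<inter> set (leaf_vars G) = {}" "read_once_formula F" "read_once_formula G"
    using FAdd.prems by (auto simp: read_once_formula_def)
  then show ?case
    using affine_rank_le_weight_node[OF _ refl refl, of "formula_poly (FAdd F G)" F G] FAdd.IH by simp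
next
  case (FMult F G)
  have "set (leaf_vars F) \<inter> set (leaf_vars G) = {}" "read_once_formula F" "read_once_formula G"
    using FMult.prems by (auto simp: read_once_formula_def)
  then show ?case
    using affine_rank_le_weight_node[OF _ refl refl, of "formula_poly (FMult F G)" F G] FMult.IH by simp
qed

lemma coeff_matrix_rank_le_weight:
  fixes F :: "('v, 'a::field) formula"
  assumes F: "read_once_formula F" and m: "finite m" "m \<inter> Q = {}"
  shows "\<exists>r. rank_le (coeff_matrix A B (formula_poly F) m) r \<and> real r \<le> weight Q A F"
proof -
  let ?V = "set (leaf_vars F)"
  have "\<exists>r. affine_rank_le A B (formula_poly F) r \<and> real r \<le> weight Q A F"
  proof (cases "card (?V \<inter> Q) \<ge> 2")
    case True
    then show ?thesis
      using affine_rank_le_weight_cases[OF F] tame_rank_le_weight by blast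
  next
    case False
    then have "weight Q A F = 1 \<or> weight Q A F = 113/80"
      using affine_rank_le_weight_cases[OF F] by linarith
    then show ?thesis
      using affine_rank_le_one_variable[OF formula_poly_mpolys_over, of F] False
      by (intro exI[of _ 1]) auto
  qed
  then obtain r where r: "affine_rank_le A B (formula_poly F) r" "real r \<le> weight Q A F"
    by blast
  have "rank_le (coeff_matrix A B (formula_poly F) m) r"
    using affine_rank_leD[OF r(1) m(1), of 1 0] m(2) Q by simp
  then show ?thesis using r(2) by blast
qed

end

section \<open>Averaging over all bipartitions\<close>

text \<open>The weight sees \<open>A\<close> only through the leaves of the formula; this yields
  independence of the weights of sibling subformulas.\<close>

lemma weight_restrict:
  "set (leaf_vars F) \<subseteq> V \<Longrightarrow> weight Q (A \<inter> V) F = weight Q A F"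
proof -
  have *: "node_weight Q (A \<inter> V) V' w = node_weight Q A V' w" if "V' \<subseteq> V" for V' and w :: real
  proof -
    have "V' \<inter> (A \<inter> V) = V' \<inter> A" using that by blast
    then show ?thesis by (simp add: node_weight_def)
  qed
  show "set (leaf_vars F) \<subseteq> V \<Longrightarrow> weight Q (A \<inter> V) F = weight Q A F"
    by (induction F) (auto simp: *)
qed

lemma weight_nonneg: "weight Q A F \<ge> 0"
  by (induction F) (auto simp: node_weight_def)

text \<open>Independence of the traces of a uniformly random subset on disjoint sets, with sums in
  place of expectations.\<close>

lemma sum_Pow_Un_disjoint:
  fixes f g :: "'v set \<Rightarrow> real"
  assumes "finite V" "finite V'" "V \<inter> V' = {}"
  shows "(\<Sum>A\<in>Pow (V \<union> V'). f (A \<inter> V) * g (A \<inter> V')) = (\<Sum>A\<in>Pow V. f A) * (\<Sum>A\<in>Pow V'. g A)"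
proof -
  have "(\<Sum>A\<in>Pow V. f A) * (\<Sum>A\<in>Pow V'. g A) = (\<Sum>(A, A')\<in>Pow V \<times> Pow V'. f A * g A')"
    by (simp add: sum_product sum.cartesian_product)
  also have "\<dots> = (\<Sum>A\<in>Pow (V \<union> V'). f (A \<inter> V) * g (A \<inter> V'))"
  proof (rule sum.reindex_bij_witness[of _ "\<lambda>A. (A \<inter> V, A \<inter> V')" "\<lambda>(A, A'). A \<union> A'"])
    fix z assume z: "z \<in> Pow V \<times> Pow V'"
    obtain a a' where [simp]: "z = (a, a')" by fastforce
    have "(a \<union> a') \<inter> V = a" "(a \<union> a') \<inter> V' = a'"
      using z assms(3) by auto
    then show "((case z of (A, A') \<Rightarrow> A \<union> A') \<inter> V, (case z of (A, A') \<Rightarrow> A \<union> A') \<inter> V') = z"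
      and "f ((case z of (A, A') \<Rightarrow> A \<union> A') \<inter> V) * g ((case z of (A, A') \<Rightarrow> A \<union> A') \<inter> V') =
        (case z of (A, A') \<Rightarrow> f A * g A')"
      by auto
  qed auto
  finally show ?thesis by simp
qed

text \<open>Two of the four subsets separate the pair, and 799/400 is the mean of 117/50 and
  331/200.\<close>

lemma sum_node_weight_pair:
  assumes "card V = 2"
  shows "(\<Sum>A\<in>Pow V. node_weight V A V w) = 4 * (799/400)"
proof -
  obtain x y where V: "V = {x, y}" and xy: "x \<noteq> y"
    using assms by (auto simp: card_2_iff)
  have Pow: "Pow V = {{}, {x}, {y}, {x, y}}"
    unfolding V by (auto simp: Pow_insert)
  show ?thesis
    unfolding Pow using xy assms by (auto simp: node_weight_def V)
qed

text \<open>In the base, 2 counts the choices for one variable and the square root shares the mean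
  799/400 of a pair between its members. At a pair the sum is explicit; at any other node it factors
  over the children.\<close>

lemma sum_weight_le_node:
  fixes Q :: "'v set" and F G :: "('v, 'a) formula"
  defines "V\<^sub>F \<equiv> set (leaf_vars F) \<inter> Q" and "V\<^sub>G \<equiv> set (leaf_vars G) \<inter> Q"
  assumes Q: "finite Q" and disj: "set (leaf_vars F) \<inter> set (leaf_vars G) = {}"
    and F: "(\<Sum>A\<in>Pow (V\<^sub>F). weight Q A F) \<le> (2 * sqrt (799/400)) ^ card (V\<^sub>F)"
    and G: "(\<Sum>A\<in>Pow (V\<^sub>G). weight Q A G) \<le> (2 * sqrt (799/400)) ^ card (V\<^sub>G)"
  shows "(\<Sum>A\<in>Pow (V\<^sub>F \<union> V\<^sub>G).
      node_weight Q A (set (leaf_vars F) \<union> set (leaf_vars G)) (weight Q A F * weight Q A G))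
    \<le> (2 * sqrt (799/400)) ^ card (V\<^sub>F \<union> V\<^sub>G)"
proof (cases "card (V\<^sub>F \<union> V\<^sub>G) = 2")
  case True
  have "(\<Sum>A\<in>Pow (V\<^sub>F \<union> V\<^sub>G).
      node_weight Q A (set (leaf_vars F) \<union> set (leaf_vars G)) (weight Q A F * weight Q A G)) =
    (\<Sum>A\<in>Pow (V\<^sub>F \<union> V\<^sub>G). node_weight (V\<^sub>F \<union> V\<^sub>G) A (V\<^sub>F \<union> V\<^sub>G) 0)"
  proof (rule sum.cong)
    fix A assume "A \<in> Pow (V\<^sub>F \<union> V\<^sub>G)"
    then have "(set (leaf_vars F) \<union> set (leaf_vars G)) \<inter> Q = V\<^sub>F \<union> V\<^sub>G"
      "(set (leaf_vars F) \<union> set (leaf_vars G)) \<inter> A = (V\<^sub>F \<union> V\<^sub>G) \<inter> A"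
      by (auto simp: V\<^sub>F_def V\<^sub>G_def)
    then show "node_weight Q A (set (leaf_vars F) \<union> set (leaf_vars G)) (weight Q A F * weight Q A G) =
        node_weight (V\<^sub>F \<union> V\<^sub>G) A (V\<^sub>F \<union> V\<^sub>G) 0"
      using True by (simp add: node_weight_def)
  qed simp
  also have "\<dots> = (2 * sqrt (799/400)) ^ card (V\<^sub>F \<union> V\<^sub>G)"
    unfolding sum_node_weight_pair[OF True] True by (simp add: power_mult_distrib)
  finally show ?thesis by simp
next
  case False
  have finV: "finite (V\<^sub>F)" "finite (V\<^sub>G)" and disjV: "V\<^sub>F \<inter> V\<^sub>G = {}"
    using Q disj by (auto simp: V\<^sub>F_def V\<^sub>G_def)
  have *: "weight Q A F * weight Q A G = weight Q (A \<inter> V\<^sub>F) F * weight Q (A \<inter> V\<^sub>G) G"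
    if "A \<in> Pow (V\<^sub>F \<union> V\<^sub>G)" for A
  proof -
    have "A \<inter> V\<^sub>F = A \<inter> set (leaf_vars F)" "A \<inter> V\<^sub>G = A \<inter> set (leaf_vars G)"
      using that by (auto simp: V\<^sub>F_def V\<^sub>G_def)
    then show ?thesis by (simp add: weight_restrict)
  qed
  have "(\<Sum>A\<in>Pow (V\<^sub>F \<union> V\<^sub>G).
      node_weight Q A (set (leaf_vars F) \<union> set (leaf_vars G)) (weight Q A F * weight Q A G)) =
    (\<Sum>A\<in>Pow (V\<^sub>F \<union> V\<^sub>G). weight Q (A \<inter> V\<^sub>F) F * weight Q (A \<inter> V\<^sub>G) G)"
    using False * by (intro sum.cong) (auto simp: node_weight_def V\<^sub>F_def V\<^sub>G_def Int_Un_distrib2)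
  also have "\<dots> = (\<Sum>A\<in>Pow (V\<^sub>F). weight Q A F) * (\<Sum>A\<in>Pow (V\<^sub>G). weight Q A G)"
    by (rule sum_Pow_Un_disjoint[OF finV disjV])
  also have "\<dots> \<le> (2 * sqrt (799/400)) ^ card (V\<^sub>F) * (2 * sqrt (799/400)) ^ card (V\<^sub>G)"
    by (intro mult_mono F G sum_nonneg weight_nonneg) auto
  also have "\<dots> = (2 * sqrt (799/400)) ^ card (V\<^sub>F \<union> V\<^sub>G)"
    by (simp add: card_Un_disjoint finV disjV power_add)
  finally show ?thesis .
qed

lemma sum_weight_leaves_le:
  fixes Q :: "'v set"
  assumes Q: "finite Q" and "read_once_formula F"
  shows "(\<Sum>A\<in>Pow (set (leaf_vars F) \<inter> Q). weight Q A F) \<le>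
    (2 * sqrt (799/400)) ^ card (set (leaf_vars F) \<inter> Q)"
  using assms(2)
proof (induction F)
  case (FVar v)
  \<comment> \<open>A leaf that never becomes part of a pair must stay below the same base:
    12769/6400 against 12784/6400 after squaring.\<close>
  have "113/80 \<le> sqrt (799/400)"
    by (rule real_le_rsqrt) (simp add: power2_eq_square)
  then show ?case by (auto simp: Pow_insert)
next
  case (FConst c)
  then show ?case by simp
next
  case (FAdd F G)
  then show ?case
    using sum_weight_le_node[OF Q, of F G] by (simp add: read_once_formula_def Int_Un_distrib2)
next
  case (FMult F G)
  then show ?case
    using sum_weight_le_node[OF Q, of F G] by (simp add: read_once_formula_def Int_Un_distrib2)
qed

lemma sum_weight_le:
  fixes Q :: "'v set"
  assumes Q: "finite Q" and F: "read_once_formula F"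
  shows "(\<Sum>A\<in>Pow Q. weight Q A F) \<le> (2 * sqrt (799/400)) ^ card Q"
proof -
  let ?V = "set (leaf_vars F) \<inter> Q" and ?V' = "Q - set (leaf_vars F)"
  have fin: "finite ?V" "finite ?V'" and disj: "?V \<inter> ?V' = {}" and Q_eq: "?V \<union> ?V' = Q"
    using Q by auto
  have "(\<Sum>A\<in>Pow Q. weight Q A F) = (\<Sum>A\<in>Pow (?V \<union> ?V'). weight Q (A \<inter> ?V) F * 1)"
  proof (rule sum.cong)
    fix A assume "A \<in> Pow (?V \<union> ?V')"
    then have "A \<inter> ?V = A \<inter> set (leaf_vars F)"
      by auto
    then show "weight Q A F = weight Q (A \<inter> ?V) F * 1"
      by (simp add: weight_restrict)
  qed (simp add: Q_eq)
  also have "\<dots> = (\<Sum>A\<in>Pow ?V. weight Q A F) * 2 ^ card ?V'"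
    unfolding sum_Pow_Un_disjoint[OF fin disj, of "\<lambda>A. weight Q A F" "\<lambda>_. 1"]
    using fin by (simp add: card_Pow)
  also have "\<dots> \<le> (2 * sqrt (799/400)) ^ card ?V * (2 * sqrt (799/400)) ^ card ?V'"
  proof (intro mult_mono sum_weight_leaves_le[OF Q F] power_mono)
    \<comment> \<open>A variable of \<open>Q\<close> absent from the formula only doubles the number
      of subsets.\<close>
    show "2 \<le> 2 * sqrt (799/400)" by simp
  qed auto
  also have "\<dots> = (2 * sqrt (799/400)) ^ card Q"
    using card_Un_disjoint[OF fin disj] by (simp add: Q_eq power_add)
  finally show ?thesis .
qed

section \<open>Coefficients of the Raz--Yehudayoff polynomial\<close>

text \<open>Confining also the indices of the \<open>W\<close>-variables to the interval makes the
  two halves of a split variable-disjoint, as \<open>sqfree_coeff_mult\<close> demands.\<close>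

definition ry_interval_vars :: "nat \<Rightarrow> nat \<Rightarrow> ry_var set" where
  "ry_interval_vars i j = X ` {i..j} \<union> {W a k b | a k b. i \<le> a \<and> a \<le> k \<and> k \<le> b \<and> b \<le> j}"

lemma X_in_ry_interval_vars [simp]: "X k \<in> ry_interval_vars i j \<longleftrightarrow> i \<le> k \<and> k \<le> j"
  by (auto simp: ry_interval_vars_def)

lemma W_in_ry_interval_vars [simp]:
  "W a k b \<in> ry_interval_vars i j \<longleftrightarrow> i \<le> a \<and> a \<le> k \<and> k \<le> b \<and> b \<le> j"
  by (auto simp: ry_interval_vars_def)

lemma ry_interval_vars_mono: "i' \<le> i \<Longrightarrow> j \<le> j' \<Longrightarrow> ry_interval_vars i j \<subseteq> ry_interval_vars i' j'"
  by (auto simp: ry_interval_vars_def)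

lemma ry_interval_empty: "j < i \<Longrightarrow> ry_interval i j = 1"
  by (subst ry_interval.simps) simp

lemma ry_interval_step:
  "i \<le> j \<Longrightarrow> ry_interval i j = (1 + mvar (X i) * mvar (X j)) * ry_interval (i + 1) (j - 1) +
    (\<Sum>k \<in> {k \<in> {i+1..j-2}. even (card {i..k})}. mvar (W i k j) * (ry_interval i k * ry_interval (k + 1) j))"
  by (subst ry_interval.simps) (simp add: mult.assoc)

lemma ry_interval_mpolys_over:
  "(ry_interval i j :: (ry_var, 'a::comm_ring_1) mpoly) \<in> mpolys_over (ry_interval_vars i j)"
proof (induction i j rule: ry_interval.induct)
  case (1 i j)
  let ?g = "ry_interval :: nat \<Rightarrow> nat \<Rightarrow> (ry_var, 'a) mpoly"
  show ?case
  proof (cases "i \<le> j")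
    case True
    then have "card {i..j} \<noteq> 0" by simp
    have "?g (i + 1) (j - 1) \<in> mpolys_over (ry_interval_vars i j)"
      by (rule mpolys_over_mono[OF "1.IH"(1)[OF \<open>card {i..j} \<noteq> 0\<close>] ry_interval_vars_mono]) auto
    moreover have "mvar (W i k j) * (?g i k * ?g (k + 1) j) \<in> mpolys_over (ry_interval_vars i j)"
      if "k \<in> {k \<in> {i+1..j-2}. even (card {i..k})}" for k
    proof (intro mpolys_over_mult mpolys_over_mvar)
      show "?g i k \<in> mpolys_over (ry_interval_vars i j)"
        using that by (intro mpolys_over_mono[OF "1.IH"(2)[OF \<open>card {i..j} \<noteq> 0\<close> that] ry_interval_vars_mono]) auto
      show "?g (k + 1) j \<in> mpolys_over (ry_interval_vars i j)"
        using that by (intro mpolys_over_mono[OF "1.IH"(3)[OF \<open>card {i..j} \<noteq> 0\<close> that] ry_interval_vars_mono]) auto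
      show "W i k j \<in> ry_interval_vars i j"
        using that by simp linarith
    qed
    ultimately show ?thesis
      unfolding ry_interval_step[OF True] using True
      by (auto simp only: X_in_ry_interval_vars intro!: mpolys_over_add[OF mpolys_over_mult mpolys_over_sum]
          mpolys_over_add[OF mpolys_over_1 mpolys_over_mult] mpolys_over_mvar)
  qed (simp add: ry_interval_empty mpolys_over_1)
qed

section \<open>Matchings selected by a \<open>W\<close>-monomial\<close>

lemma card_Int_atLeastAtMost_Suc:
  "i \<le> Suc t \<Longrightarrow> card (A \<inter> {i..Suc t}) = card (A \<inter> {i..t}) + (if Suc t \<in> A then 1 else 0)"
  by (simp add: atLeastAtMostSuc_conv Int_insert_right)

text \<open>A discrete intermediate value argument: the imbalance of a prefix moves by one unit per
  element. Equal endpoints force it to have opposite signs after the first element and before the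
  last, so it vanishes in between.\<close>

lemma exists_balanced_prefix:
  fixes i j :: nat
  assumes ij: "i < j" and balanced: "2 * card (A \<inter> {i..j}) = card {i..j}" and same: "i \<in> A \<longleftrightarrow> j \<in> A"
  shows "\<exists>k\<in>{i+1..j-2}. 2 * card (A \<inter> {i..k}) = card {i..k}"
proof -
  define D where "D t = 2 * int (card (A \<inter> {i..t})) - int (card {i..t})" for t
  \<comment> \<open>The sign normalizes the walk to start at -1 and to stand at 1 just before
    \<open>j\<close>.\<close>
  define s where "s = (if i \<in> A then -1 else 1 :: int)"
  have step: "D (Suc t) = D t + (if Suc t \<in> A then 1 else -1)" if "i \<le> t" for t
    using that by (simp add: D_def card_Int_atLeastAtMost_Suc)
  have "A \<inter> {i} = (if i \<in> A then {i} else {})" by auto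
  then have Di: "s * D i = -1"
    by (simp add: D_def s_def)
  obtain j' where j': "j = Suc j'" "i \<le> j'"
    using ij by (cases j) auto
  have "D j = 0"
    using balanced by (simp add: D_def)
  then have Dj: "s * D j' = 1"
    using step[OF j'(2)] same by (auto simp: s_def j' split: if_splits)
  have "\<exists>k. i \<le> k \<and> k \<le> j' \<and> s * D k = 0"
    using Di Dj j'(2) by (intro nat_intermed_int_val) (auto simp: step s_def)
  then obtain k where k: "i \<le> k" "k \<le> j'" "s * D k = 0" by blast
  then have "k \<noteq> i" "k \<noteq> j'" using Di Dj by auto
  moreover have "D k = 0" using k by (simp add: s_def split: if_splits)
  ultimately show ?thesis
    using k j' by (intro bexI[of _ k]) (auto simp: D_def)
qed

text \<open>The coefficient of the \<open>W\<close>-monomial \<open>m\<close> is \<open>\<Prod>a. 1 + x\<^sub>a x\<^bsub>f a\<^esub>\<close>, the product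
  ranging over the \<open>A\<close>-part of the interval.\<close>

definition ry_matching :: "'a::comm_ring_1 itself \<Rightarrow> nat set \<Rightarrow> nat \<Rightarrow> nat \<Rightarrow> ry_var set \<Rightarrow> (nat \<Rightarrow> nat) \<Rightarrow> bool" where
  "ry_matching T A i j m f \<longleftrightarrow> finite m \<and> m \<subseteq> ry_interval_vars i j - range X \<and>
    bij_betw f (A \<inter> {i..j}) ({i..j} - A) \<and>
    (\<forall>K \<subseteq> {i..j}. sqfree_coeff (ry_interval i j :: (ry_var, 'a) mpoly) (m \<union> X ` K) =
      (if \<forall>a \<in> A \<inter> {i..j}. a \<in> K \<longleftrightarrow> f a \<in> K then 1 else 0))"

text \<open>The inner \<open>m\<close> contains no \<open>W i k j\<close>, so every split term
  vanishes at this coefficient. The remaining factor \<open>1 + x_i x_j\<close> lets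
  \<open>i\<close> and \<open>j\<close> enter \<open>K\<close> only together, which adds the pair to
  the matching.\<close>

lemma ry_matching_outer:
  assumes ij: "i < j" and ab: "{a, b} = {i, j}" "a \<in> A" "b \<notin> A"
    and inner: "ry_matching TYPE('a::comm_ring_1) A (i + 1) (j - 1) m f"
  shows "ry_matching TYPE('a) A i j m (f(a := b))"
proof -
  let ?g = "ry_interval (i + 1) (j - 1) :: (ry_var, 'a) mpoly"
  let ?V = "ry_interval_vars (i + 1) (j - 1)"
  have g: "?g \<in> mpolys_over ?V"
    by (rule ry_interval_mpolys_over)
  have m: "finite m" "m \<subseteq> ?V" "\<And>k. X k \<notin> m"
    and f: "bij_betw f (A \<inter> {i+1..j-1}) ({i+1..j-1} - A)"
    and coeff: "\<And>K. K \<subseteq> {i+1..j-1} \<Longrightarrow> sqfree_coeff ?g (m \<union> X ` K) =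
      (if \<forall>a \<in> A \<inter> {i+1..j-1}. a \<in> K \<longleftrightarrow> f a \<in> K then 1 else 0)"
    using inner unfolding ry_matching_def by auto
  have ends: "{i..j} = insert i (insert j {i+1..j-1})"
    using ij by auto
  have A: "A \<inter> {i..j} = insert a (A \<inter> {i+1..j-1})" and B: "{i..j} - A = insert b ({i+1..j-1} - A)"
    unfolding ends using ij ab by (auto simp: doubleton_eq_iff)
  have notin: "a \<notin> {i+1..j-1}" "b \<notin> {i+1..j-1}"
    using ij ab by (auto simp: doubleton_eq_iff)
  have "bij_betw (f(a := b)) (A \<inter> {i+1..j-1}) ({i+1..j-1} - A)"
    using f notin bij_betw_cong[of "A \<inter> {i+1..j-1}" f "f(a := b)"] by fastforce
  then have "bij_betw (f(a := b)) ({a} \<union> A \<inter> {i+1..j-1}) ({b} \<union> ({i+1..j-1} - A))"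
    using notin by (intro bij_betw_combine) (auto simp: bij_betw_def)
  then have "bij_betw (f(a := b)) (A \<inter> {i..j}) ({i..j} - A)"
    unfolding A B by simp
  moreover have "sqfree_coeff (ry_interval i j :: (ry_var, 'a) mpoly) (m \<union> X ` K) =
      (if \<forall>a' \<in> A \<inter> {i..j}. a' \<in> K \<longleftrightarrow> (f(a := b)) a' \<in> K then 1 else 0)" if K: "K \<subseteq> {i..j}" for K
  proof -
    let ?L = "m \<union> X ` K"
    have L: "finite ?L" using m K finite_subset by blast
    have "sqfree_coeff (mvar (W i k j) * (ry_interval i k * ry_interval (k + 1) j) :: (ry_var, 'a) mpoly) ?L = 0"
      if "k \<in> {k \<in> {i+1..j-2}. even (card {i..k})}" for k
    proof -
      have "ry_interval i k * ry_interval (k + 1) j \<in> (mpolys_over (ry_interval_vars i k \<union> ry_interval_vars (k + 1) j) :: (ry_var, 'a) mpoly set)"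
        by (intro mpolys_over_mult) (auto intro: mpolys_over_mono[OF ry_interval_mpolys_over])
      moreover have "W i k j \<notin> ?L" using m(2) by auto
      ultimately show ?thesis
        using that L by (subst sqfree_coeff_mvar_mult) auto
    qed
    then have "(\<Sum>k \<in> {k \<in> {i+1..j-2}. even (card {i..k})}.
        sqfree_coeff (mvar (W i k j) * (ry_interval i k * ry_interval (k + 1) j) :: (ry_var, 'a) mpoly) ?L) = 0"
      by (intro sum.neutral) blast
    moreover have "(1 + mvar (X i) * mvar (X j)) * ?g = ?g + mvar (X i) * (mvar (X j) * ?g)"
      by (simp add: algebra_simps)
    ultimately have "sqfree_coeff (ry_interval i j :: (ry_var, 'a) mpoly) ?L =
        sqfree_coeff (?g + mvar (X i) * (mvar (X j) * ?g)) ?L"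
      by (simp only: ry_interval_step[OF less_imp_le[OF ij]] sqfree_coeff_add sqfree_coeff_sum add_0_right)
    also have "\<dots> = sqfree_coeff ?g ?L + sqfree_coeff (mvar (X i) * (mvar (X j) * ?g)) ?L"
      by simp
    also have "sqfree_coeff (mvar (X i) * (mvar (X j) * ?g)) ?L =
        (if X i \<in> ?L then sqfree_coeff (mvar (X j) * ?g) (?L - {X i}) else 0)"
    proof (rule sqfree_coeff_mvar_mult[OF _ _ L])
      show "mvar (X j) * ?g \<in> mpolys_over (insert (X j) ?V)"
        by (intro mpolys_over_mult mpolys_over_mvar mpolys_over_mono[OF g]) auto
    qed (use ij in auto)
    also have "sqfree_coeff (mvar (X j) * ?g) (?L - {X i}) =
        (if X j \<in> ?L - {X i} then sqfree_coeff ?g (?L - {X i} - {X j}) else 0)"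
      using L by (intro sqfree_coeff_mvar_mult[OF g]) auto
    also have "sqfree_coeff ?g ?L + (if X i \<in> ?L then if X j \<in> ?L - {X i}
          then sqfree_coeff ?g (?L - {X i} - {X j}) else 0 else 0) =
        (if (i \<in> K \<longleftrightarrow> j \<in> K) then sqfree_coeff ?g (m \<union> X ` (K - {i, j})) else 0)"
    proof -
      have Xi: "X k \<in> ?L \<longleftrightarrow> k \<in> K" for k
        using m(3) by auto
      have rest: "m \<union> X ` K - {X i} - {X j} = m \<union> X ` (K - {i, j})"
        using m(3) by auto
      have out: "sqfree_coeff ?g ?L = 0" if "i \<in> K \<or> j \<in> K"
        using that ij by (intro sqfree_coeff_outside[OF g L]) auto
      have "K - {i, j} = K" if "i \<notin> K" "j \<notin> K" using that by auto
      then show ?thesis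
        using out ij m(3) unfolding rest by auto
    qed
    also have "sqfree_coeff ?g (m \<union> X ` (K - {i, j})) =
        (if \<forall>a \<in> A \<inter> {i+1..j-1}. a \<in> K - {i, j} \<longleftrightarrow> f a \<in> K - {i, j} then 1 else 0)"
      using K unfolding ends by (intro coeff) auto
    also have "(\<forall>a \<in> A \<inter> {i+1..j-1}. a \<in> K - {i, j} \<longleftrightarrow> f a \<in> K - {i, j}) \<longleftrightarrow>
        (\<forall>a' \<in> A \<inter> {i+1..j-1}. a' \<in> K \<longleftrightarrow> (f(a := b)) a' \<in> K)"
    proof (rule ball_cong[OF refl])
      fix a' assume a': "a' \<in> A \<inter> {i+1..j-1}"
      then have "f a' \<in> {i+1..j-1}"
        using bij_betwE[OF f] by blast
      then show "(a' \<in> K - {i, j} \<longleftrightarrow> f a' \<in> K - {i, j}) \<longleftrightarrow> (a' \<in> K \<longleftrightarrow> (f(a := b)) a' \<in> K)"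
        using a' notin ij by auto
    qed
    also have "(if (i \<in> K \<longleftrightarrow> j \<in> K) then (if (\<forall>a' \<in> A \<inter> {i+1..j-1}. a' \<in> K \<longleftrightarrow> (f(a := b)) a' \<in> K)
          then 1 else 0) else 0 :: 'a) =
        (if \<forall>a' \<in> A \<inter> {i..j}. a' \<in> K \<longleftrightarrow> (f(a := b)) a' \<in> K then 1 else 0)"
      unfolding A using ab(1) by (auto simp: doubleton_eq_iff)
    finally show ?thesis .
  qed
  moreover have "m \<subseteq> ry_interval_vars i j - range X"
    using m ry_interval_vars_mono[of i "i + 1" "j - 1" j] by auto
  ultimately show ?thesis
    using m(1) unfolding ry_matching_def by blast
qed

text \<open>Adding \<open>W i k j\<close> to the monomial kills the outer term and every split
  except the one at \<open>k\<close>. The coefficient then factors over the two halves, and the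
  matchings are united.\<close>

lemma ry_matching_split:
  assumes k: "k \<in> {i+1..j-2}" "even (card {i..k})"
    and left: "ry_matching TYPE('a::comm_ring_1) A i k m1 f1"
    and right: "ry_matching TYPE('a) A (k + 1) j m2 f2"
  shows "ry_matching TYPE('a) A i j (insert (W i k j) (m1 \<union> m2)) (\<lambda>a. if a \<in> A \<inter> {i..k} then f1 a else f2 a)"
proof -
  let ?f = "\<lambda>a. if a \<in> A \<inter> {i..k} then f1 a else f2 a"
  let ?g1 = "ry_interval i k :: (ry_var, 'a) mpoly" and ?g2 = "ry_interval (k + 1) j :: (ry_var, 'a) mpoly"
  let ?V1 = "ry_interval_vars i k" and ?V2 = "ry_interval_vars (k + 1) j"
  let ?m = "insert (W i k j) (m1 \<union> m2)"
  have ikj: "i < k" "k + 2 \<le> j" using k by auto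
  have g1: "?g1 \<in> mpolys_over ?V1" and g2: "?g2 \<in> mpolys_over ?V2"
    by (rule ry_interval_mpolys_over)+
  have V12: "?V1 \<inter> ?V2 = {}"
    by (auto simp: ry_interval_vars_def)
  have m1: "finite m1" "m1 \<subseteq> ?V1" "\<And>k. X k \<notin> m1"
    and f1: "bij_betw f1 (A \<inter> {i..k}) ({i..k} - A)"
    and coeff1: "\<And>K. K \<subseteq> {i..k} \<Longrightarrow> sqfree_coeff ?g1 (m1 \<union> X ` K) =
      (if \<forall>a \<in> A \<inter> {i..k}. a \<in> K \<longleftrightarrow> f1 a \<in> K then 1 else 0)"
    using left unfolding ry_matching_def by auto
  have m2: "finite m2" "m2 \<subseteq> ?V2" "\<And>k. X k \<notin> m2"
    and f2: "bij_betw f2 (A \<inter> {k+1..j}) ({k+1..j} - A)"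
    and coeff2: "\<And>K. K \<subseteq> {k+1..j} \<Longrightarrow> sqfree_coeff ?g2 (m2 \<union> X ` K) =
      (if \<forall>a \<in> A \<inter> {k+1..j}. a \<in> K \<longleftrightarrow> f2 a \<in> K then 1 else 0)"
    using right unfolding ry_matching_def by auto
  have A: "A \<inter> {i..j} = A \<inter> {i..k} \<union> A \<inter> {k+1..j}" and B: "{i..j} - A = ({i..k} - A) \<union> ({k+1..j} - A)"
    using ikj by auto
  have "bij_betw ?f (A \<inter> {i..j}) ({i..j} - A)"
    unfolding A B by (intro bij_betw_disjoint_Un f1 f2) auto
  moreover have "sqfree_coeff (ry_interval i j :: (ry_var, 'a) mpoly) (?m \<union> X ` K) =
      (if \<forall>a \<in> A \<inter> {i..j}. a \<in> K \<longleftrightarrow> ?f a \<in> K then 1 else 0)" if K: "K \<subseteq> {i..j}" for K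
  proof -
    let ?L = "?m \<union> X ` K"
    have L: "finite ?L" using m1 m2 K finite_subset by blast
    have W_in: "W i k' j \<in> ?L \<longleftrightarrow> k' = k" for k'
      using m1(2) m2(2) ikj by auto
    have zero: "sqfree_coeff ((1 + mvar (X i) * mvar (X j)) * ry_interval (i + 1) (j - 1) :: (ry_var, 'a) mpoly) ?L = 0"
    proof (rule sqfree_coeff_outside[OF _ L])
      show "(1 + mvar (X i) * mvar (X j)) * ry_interval (i + 1) (j - 1) \<in>
          (mpolys_over ({X i, X j} \<union> ry_interval_vars (i + 1) (j - 1)) :: (ry_var, 'a) mpoly set)"
        by (intro mpolys_over_mult mpolys_over_add mpolys_over_1 mpolys_over_mvar
            mpolys_over_mono[OF ry_interval_mpolys_over]) auto
    qed auto
    have summand: "sqfree_coeff (mvar (W i k' j) * (ry_interval i k' * ry_interval (k' + 1) j) :: (ry_var, 'a) mpoly) ?L =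
        (if k' = k then sqfree_coeff (?g1 * ?g2) (?L - {W i k j}) else 0)"
      if "k' \<in> {k \<in> {i+1..j-2}. even (card {i..k})}" for k'
    proof -
      have "ry_interval i k' * ry_interval (k' + 1) j \<in> (mpolys_over (ry_interval_vars i k' \<union> ry_interval_vars (k' + 1) j) :: (ry_var, 'a) mpoly set)"
        by (intro mpolys_over_mult) (auto intro: mpolys_over_mono[OF ry_interval_mpolys_over])
      then show ?thesis
        using that L by (subst sqfree_coeff_mvar_mult) (auto simp only: W_in, auto)
    qed
    have "sqfree_coeff (ry_interval i j :: (ry_var, 'a) mpoly) ?L =
        (\<Sum>k' \<in> {k \<in> {i+1..j-2}. even (card {i..k})}.
          if k' = k then sqfree_coeff (?g1 * ?g2) (?L - {W i k j}) else 0)"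
      using ikj by (subst ry_interval_step)
        (simp_all only: sqfree_coeff_add zero sqfree_coeff_sum summand cong: sum.cong, simp_all)
    also have "\<dots> = sqfree_coeff (?g1 * ?g2) (?L - {W i k j})"
      using k by simp
    also have "\<dots> = sqfree_coeff ?g1 ((?L - {W i k j}) \<inter> ?V1) * sqfree_coeff ?g2 (?L - {W i k j} - ?V1)"
      using L by (intro sqfree_coeff_mult[OF g1 g2 V12]) auto
    also have "(?L - {W i k j}) \<inter> ?V1 = m1 \<union> X ` (K \<inter> {i..k})"
      using m1 m2 V12 ikj by auto
    also have "?L - {W i k j} - ?V1 = m2 \<union> X ` (K \<inter> {k+1..j})"
      using m1 m2 V12 ikj K by auto
    also have "sqfree_coeff ?g1 (m1 \<union> X ` (K \<inter> {i..k})) * sqfree_coeff ?g2 (m2 \<union> X ` (K \<inter> {k+1..j})) =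
        (if (\<forall>a \<in> A \<inter> {i..k}. a \<in> K \<inter> {i..k} \<longleftrightarrow> f1 a \<in> K \<inter> {i..k}) \<and>
            (\<forall>a \<in> A \<inter> {k+1..j}. a \<in> K \<inter> {k+1..j} \<longleftrightarrow> f2 a \<in> K \<inter> {k+1..j}) then 1 else 0)"
    proof -
      have "(if P then 1 else 0) * (if R then 1 else 0) = (if P \<and> R then 1 else 0 :: 'a)" for P R
        by simp
      then show ?thesis
        by (simp only: coeff1[OF Int_lower2] coeff2[OF Int_lower2])
    qed
    also have "(\<forall>a \<in> A \<inter> {i..k}. a \<in> K \<inter> {i..k} \<longleftrightarrow> f1 a \<in> K \<inter> {i..k}) \<longleftrightarrow>
        (\<forall>a \<in> A \<inter> {i..k}. a \<in> K \<longleftrightarrow> ?f a \<in> K)"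
      using bij_betwE[OF f1] by (intro ball_cong) auto
    also have "(\<forall>a \<in> A \<inter> {k+1..j}. a \<in> K \<inter> {k+1..j} \<longleftrightarrow> f2 a \<in> K \<inter> {k+1..j}) \<longleftrightarrow>
        (\<forall>a \<in> A \<inter> {k+1..j}. a \<in> K \<longleftrightarrow> ?f a \<in> K)"
      using bij_betwE[OF f2] by (intro ball_cong) auto
    finally show ?thesis
      unfolding A ball_Un .
  qed
  moreover have "?m \<subseteq> ry_interval_vars i j - range X"
    using m1 m2 ikj ry_interval_vars_mono[of i i k j] ry_interval_vars_mono[of i "k + 1" j j] by auto
  ultimately show ?thesis
    using m1(1) m2(1) unfolding ry_matching_def by blast
qed

text \<open>Endpoints on opposite sides are matched with each other; endpoints on the same side
  allow a split into two balanced intervals.\<close>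

lemma ry_matching_exists:
  assumes "1 \<le> i" "2 * card (A \<inter> {i..j}) = card {i..j}"
  shows "\<exists>m f. ry_matching TYPE('a::comm_ring_1) A i j m f"
  using assms
proof (induction "Suc j - i" arbitrary: i j rule: less_induct)
  case less
  consider "j < i" | "i = j" | "i < j" by linarith
  then show ?case
  proof cases
    case 1
    then have "ry_matching TYPE('a) A i j {} id"
      by (simp add: ry_matching_def ry_interval_empty sqfree_coeff_one bij_betw_def)
    then show ?thesis by blast
  next
    case 2
    then show ?thesis using less.prems by simp
  next
    case 3
    show ?thesis
    proof (cases "i \<in> A \<longleftrightarrow> j \<in> A")
      case True
      then obtain k where k: "k \<in> {i+1..j-2}" "2 * card (A \<inter> {i..k}) = card {i..k}"
        using exists_balanced_prefix[OF 3 less.prems(2)] by blast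
      have "{i..j} = {i..k} \<union> {k+1..j}" using k by auto
      then have "card (A \<inter> {i..j}) = card (A \<inter> {i..k}) + card (A \<inter> {k+1..j})"
        and "card {i..j} = card {i..k} + card {k+1..j}"
        by (subst card_Un_disjoint[symmetric]; auto simp: Int_Un_distrib)+
      then have k': "2 * card (A \<inter> {k+1..j}) = card {k+1..j}"
        using k(2) less.prems(2) by linarith
      obtain m1 f1 where 1: "ry_matching TYPE('a) A i k m1 f1"
        using less.hyps[of k i] k less.prems(1) by fastforce
      obtain m2 f2 where 2: "ry_matching TYPE('a) A (k + 1) j m2 f2"
        using less.hyps[of j "k + 1"] k k' by fastforce
      have "even (card {i..k})" using k(2) by presburger
      then show ?thesis using ry_matching_split[OF k(1) _ 1 2] by blast
    next
      case False
      define a where "a = (if i \<in> A then i else j)"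
      define b where "b = (if i \<in> A then j else i)"
      have ab: "{a, b} = {i, j}" "a \<in> A" "b \<notin> A"
        using False by (auto simp: a_def b_def)
      have ends: "{i..j} = insert i (insert j {i+1..j-1})"
        using 3 by auto
      have "A \<inter> {i..j} = insert a (A \<inter> {i+1..j-1})" "a \<notin> A \<inter> {i+1..j-1}"
        unfolding ends using False 3 by (auto simp: a_def)
      then have "card (A \<inter> {i..j}) = Suc (card (A \<inter> {i+1..j-1}))"
        by simp
      then have "2 * card (A \<inter> {i+1..j-1}) = card {i+1..j-1}"
        using less.prems(2) 3 by simp
      then obtain m f where "ry_matching TYPE('a) A (i + 1) (j - 1) m f"
        using less.hyps[of "j - 1" "i + 1"] 3 by fastforce
      then show ?thesis using ry_matching_outer[OF 3 ab] by blast
    qed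
  qed
qed

section \<open>Degree and circuit size\<close>

lemma monom_degree_eq_sum:
  "finite V \<Longrightarrow> Poly_Mapping.keys m \<subseteq> V \<Longrightarrow> monom_degree m = (\<Sum>v\<in>V. Poly_Mapping.lookup m v)"
  unfolding monom_degree_def by (rule sum.mono_neutral_left) (auto simp: in_keys_iff)

lemma monom_degree_add: "monom_degree (a + b) = monom_degree a + monom_degree b"
proof -
  let ?V = "Poly_Mapping.keys a \<union> Poly_Mapping.keys b"
  have "monom_degree (a + b) = (\<Sum>v\<in>?V. Poly_Mapping.lookup (a + b) v)"
    by (rule monom_degree_eq_sum) (simp_all add: keys_add)
  also have "\<dots> = monom_degree a + monom_degree b"
    by (simp add: lookup_add sum.distrib monom_degree_eq_sum[of ?V])
  finally show ?thesis .
qed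

lemma total_degree_le_iff:
  "total_degree p \<le> d \<longleftrightarrow> (\<forall>m \<in> Poly_Mapping.keys p. monom_degree m \<le> d)"
  by (simp add: total_degree_def)

lemma monom_degree_le_total_degree: "m \<in> Poly_Mapping.keys p \<Longrightarrow> monom_degree m \<le> total_degree p"
  using total_degree_le_iff by blast

lemma total_degree_add: "total_degree (p + q) \<le> max (total_degree p) (total_degree q)"
  unfolding total_degree_le_iff
  using keys_add[of p q] monom_degree_le_total_degree by (force simp: le_max_iff_disj)

lemma total_degree_mult: "total_degree (p * q) \<le> total_degree p + total_degree q"
  unfolding total_degree_le_iff
proof
  fix m assume "m \<in> Poly_Mapping.keys (p * q)"
  then obtain a b where "m = a + b" "a \<in> Poly_Mapping.keys p" "b \<in> Poly_Mapping.keys q"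
    using keys_mult[of p q] by blast
  then show "monom_degree m \<le> total_degree p + total_degree q"
    by (simp add: monom_degree_add add_mono monom_degree_le_total_degree)
qed

lemma total_degree_sum:
  "(\<And>i. i \<in> I \<Longrightarrow> total_degree (f i) \<le> d) \<Longrightarrow> total_degree (sum f I) \<le> d"
proof (induction I rule: infinite_finite_induct)
  case (insert i I)
  then show ?case
    using order_trans[OF total_degree_add[of "f i" "sum f I"], of d] by simp
qed (simp_all add: total_degree_def)

lemma total_degree_1 [simp]: "total_degree (1 :: ('v, 'a::comm_ring_1) mpoly) = 0"
  by (simp add: total_degree_def monom_degree_def)

lemma total_degree_mvar: "total_degree (mvar v :: ('v, 'a::comm_ring_1) mpoly) \<le> 1"
  by (simp add: total_degree_le_iff mvar_def monom_degree_def)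

text \<open>The bound is exactly stable under splits:
  \<open>(3a - 1) + (3b - 1) + 1 = 3(a + b) - 1\<close>. Truncated subtraction makes it 0 on the
  empty interval.\<close>

lemma total_degree_ry_interval:
  "total_degree (ry_interval i j :: (ry_var, 'a::comm_ring_1) mpoly) \<le> 3 * card {i..j} - 1"
proof (induction i j rule: ry_interval.induct)
  case (1 i j)
  let ?g = "ry_interval :: nat \<Rightarrow> nat \<Rightarrow> (ry_var, 'a) mpoly"
  show ?case
  proof (cases "i \<le> j")
    case True
    then have nonempty: "card {i..j} \<noteq> 0" by simp
    have "total_degree (mvar (X i) * mvar (X j) :: (ry_var, 'a) mpoly) \<le> 2"
      using total_degree_mult[of "mvar (X i)" "mvar (X j)"] total_degree_mvar[of "X i"] total_degree_mvar[of "X j"]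
      by (metis (no_types, lifting) add_mono le_trans one_add_one)
    then have "total_degree (1 + mvar (X i) * mvar (X j) :: (ry_var, 'a) mpoly) \<le> 2"
      using total_degree_add[of 1 "mvar (X i) * mvar (X j) :: (ry_var, 'a) mpoly"] by simp
    moreover have "2 + total_degree (?g (i + 1) (j - 1)) \<le> 3 * card {i..j} - 1"
      using "1.IH"(1)[OF nonempty] True by simp
    ultimately have first: "total_degree ((1 + mvar (X i) * mvar (X j)) * ?g (i + 1) (j - 1)) \<le> 3 * card {i..j} - 1"
      using total_degree_mult[of "1 + mvar (X i) * mvar (X j)" "?g (i + 1) (j - 1)"] by linarith
    have "total_degree (mvar (W i k j) * (?g i k * ?g (k + 1) j)) \<le> 3 * card {i..j} - 1"
      if k: "k \<in> {k \<in> {i+1..j-2}. even (card {i..k})}" for k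
    proof -
      have "total_degree (?g i k) \<le> 3 * (Suc k - i) - 1" "total_degree (?g (k + 1) j) \<le> 3 * (j - k) - 1"
        using "1.IH"(2,3)[OF nonempty k] by simp_all
      moreover have "i < k" "k < j" using k by auto
      ultimately have "1 + (total_degree (?g i k) + total_degree (?g (k + 1) j)) \<le> 3 * card {i..j} - 1"
        by simp
      then show ?thesis
        using total_degree_mult[of "mvar (W i k j)" "?g i k * ?g (k + 1) j"]
          total_degree_mult[of "?g i k" "?g (k + 1) j"] total_degree_mvar[of "W i k j", where 'a = 'a]
        by linarith
    qed
    then show ?thesis
      unfolding ry_interval_step[OF True]
      using first by (intro order_trans[OF total_degree_add] max.boundedI total_degree_sum) auto
  qed (simp add: ry_interval_empty)
qed

section \<open>Circuits built gate by gate\<close>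

lemma circuit_polys_snoc: "circuit_polys (C @ [G]) = circuit_polys C @ [gate_poly (circuit_polys C) G]"
  by (simp add: circuit_polys_def)

lemma length_circuit_polys [simp]: "length (circuit_polys C) = length C"
  by (induction C rule: rev_induct) (simp_all add: circuit_polys_snoc, simp add: circuit_polys_def)

text \<open>A set of polynomials available at the gates of one circuit. Gate positions and the
  output gate are hidden, while intermediate results remain shareable, which keeps the size
  polynomial.\<close>

definition circuit_reaches :: "('v, 'a::comm_ring_1) mpoly set \<Rightarrow> nat \<Rightarrow> bool" where
  "circuit_reaches P s \<longleftrightarrow>
    (\<exists>C. (\<forall>t < length C. gate_wf t (C ! t)) \<and> length C \<le> s \<and> P \<subseteq> set (circuit_polys C))"

lemma circuit_reaches_empty: "circuit_reaches {} 0"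
  by (auto simp: circuit_reaches_def)

lemma circuit_reaches_mono: "circuit_reaches P s \<Longrightarrow> P' \<subseteq> P \<Longrightarrow> s \<le> s' \<Longrightarrow> circuit_reaches P' s'"
  unfolding circuit_reaches_def by (meson le_trans subset_trans)

lemma circuit_reaches_snoc:
  assumes "\<forall>t < length C. gate_wf t (C ! t)" "length C \<le> s" "P \<subseteq> set (circuit_polys C)" "gate_wf (length C) G"
  shows "circuit_reaches (insert (gate_poly (circuit_polys C) G) P) (Suc s)"
  unfolding circuit_reaches_def
  using assms by (intro exI[of _ "C @ [G]"]) (auto simp: circuit_polys_snoc nth_append less_Suc_eq)

lemma circuit_reaches_mvar: "circuit_reaches P s \<Longrightarrow> circuit_reaches (insert (mvar v) P) (Suc s)"
  unfolding circuit_reaches_def[of P s] using circuit_reaches_snoc[where G = "GVar v"] by fastforce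

lemma circuit_reaches_mconst: "circuit_reaches P s \<Longrightarrow> circuit_reaches (insert (mconst c) P) (Suc s)"
  unfolding circuit_reaches_def[of P s] using circuit_reaches_snoc[where G = "GConst c"] by fastforce

lemma circuit_reaches_op:
  assumes "circuit_reaches P s" "p \<in> P" "q \<in> P"
  shows "circuit_reaches (insert (p + q) P) (Suc s)" "circuit_reaches (insert (p * q) P) (Suc s)"
proof -
  obtain C where C: "\<forall>t < length C. gate_wf t (C ! t)" "length C \<le> s" "P \<subseteq> set (circuit_polys C)"
    using assms(1) by (auto simp: circuit_reaches_def)
  obtain l r where "l < length C" "circuit_polys C ! l = p" "r < length C" "circuit_polys C ! r = q"
    using C(3) assms(2,3) by (metis in_set_conv_nth length_circuit_polys subsetD)
  then show "circuit_reaches (insert (p + q) P) (Suc s)" "circuit_reaches (insert (p * q) P) (Suc s)"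
    using circuit_reaches_snoc[OF C, of "GAdd l r"] circuit_reaches_snoc[OF C, of "GMult l r"] by auto
qed

text \<open>The gate for \<open>p\<close> may stand anywhere; two more gates, the constant 0 and the
  sum \<open>p + 0\<close>, turn it into the output.\<close>

lemma circuit_reaches_imp_computes:
  assumes "circuit_reaches P s" "p \<in> P"
  shows "\<exists>C. circuit_computes C p \<and> length C \<le> s + 2"
proof -
  obtain C where C: "\<forall>t < length C. gate_wf t (C ! t)" "length C \<le> s" "P \<subseteq> set (circuit_polys C)"
    using assms(1) by (auto simp: circuit_reaches_def)
  obtain l where l: "l < length C" "circuit_polys C ! l = p"
    using C(3) assms(2) by (metis in_set_conv_nth length_circuit_polys subsetD)
  let ?C = "(C @ [GConst 0]) @ [GAdd l (length C)]"
  have "circuit_wf ?C"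
    using C l by (auto simp: circuit_wf_def nth_append less_Suc_eq)
  moreover have "last (circuit_polys ?C) = p"
    using l by (simp only: circuit_polys_snoc) (simp add: nth_append mconst_def)
  ultimately show ?thesis
    using C by (intro exI[of _ ?C]) (simp add: circuit_computes_def)
qed

text \<open>One gate for the initial 0, then four per summand: two products, a variable and an
  addition.\<close>

lemma circuit_reaches_sum:
  assumes P: "circuit_reaches P s" and "finite K" and "\<And>k. k \<in> K \<Longrightarrow> a k \<in> P \<and> b k \<in> P"
  shows "circuit_reaches (insert (\<Sum>k\<in>K. mvar (v k) * (a k * b k)) P) (s + 1 + 4 * card K)"
  using assms(2,3)
proof (induction K rule: finite_induct)
  case empty
  then show ?case
    using circuit_reaches_mconst[OF P, of 0] by (simp add: mconst_def)
next
  case (insert k K)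
  let ?S = "\<Sum>k\<in>K. mvar (v k) * (a k * b k)"
  let ?ab = "a k * b k" and ?v = "mvar (v k)"
  have "circuit_reaches (insert ?S P) (s + 1 + 4 * card K)"
    using insert by auto
  then have "circuit_reaches (insert ?ab (insert ?S P)) (Suc (s + 1 + 4 * card K))"
    by (rule circuit_reaches_op) (use insert.prems in auto)
  then have "circuit_reaches (insert ?v (insert ?ab (insert ?S P))) (Suc (Suc (s + 1 + 4 * card K)))"
    by (rule circuit_reaches_mvar)
  then have "circuit_reaches (insert (?v * ?ab) (insert ?v (insert ?ab (insert ?S P))))
      (Suc (Suc (Suc (s + 1 + 4 * card K))))"
    by (rule circuit_reaches_op) auto
  then have "circuit_reaches (insert (?v * ?ab + ?S) (insert (?v * ?ab) (insert ?v (insert ?ab (insert ?S P)))))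
      (Suc (Suc (Suc (Suc (s + 1 + 4 * card K)))))"
    by (rule circuit_reaches_op) auto
  then show ?case
    by (rule circuit_reaches_mono) (use insert in auto)
qed

text \<open>At most \<open>1 + 4 * N\<close> gates for the sum over splits and six for the outer
  term and the final addition.\<close>

lemma circuit_reaches_ry_step:
  fixes P :: "(ry_var, 'a::comm_ring_1) mpoly set"
  assumes P: "circuit_reaches P s" and ij: "i \<le> j" "j \<le> N"
    and one: "1 \<in> P" and inner: "ry_interval (i + 1) (j - 1) \<in> P"
    and parts: "\<And>k. k \<in> {i+1..j-2} \<Longrightarrow> ry_interval i k \<in> P \<and> ry_interval (k + 1) j \<in> P"
  shows "circuit_reaches (insert (ry_interval i j) P) (s + (7 + 4 * N))"
proof -
  let ?K = "{k \<in> {i+1..j-2}. even (card {i..k})}"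
  let ?S = "\<Sum>k \<in> ?K. mvar (W i k j) * (ry_interval i k * ry_interval (k + 1) j) :: (ry_var, 'a) mpoly"
  let ?x = "mvar (X i)" and ?y = "mvar (X j)" and ?g = "ry_interval (i + 1) (j - 1) :: (ry_var, 'a) mpoly"
  define s' where "s' = s + 1 + 4 * card ?K"
  have "circuit_reaches (insert ?S P) s'"
    unfolding s'_def using parts by (intro circuit_reaches_sum[OF P]) auto
  then have "circuit_reaches (insert ?x (insert ?S P)) (Suc s')"
    by (rule circuit_reaches_mvar)
  then have "circuit_reaches (insert ?y (insert ?x (insert ?S P))) (Suc (Suc s'))"
    by (rule circuit_reaches_mvar)
  then have "circuit_reaches (insert (?x * ?y) (insert ?y (insert ?x (insert ?S P)))) (Suc (Suc (Suc s')))"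
    by (rule circuit_reaches_op) auto
  then have "circuit_reaches (insert (1 + ?x * ?y) (insert (?x * ?y) (insert ?y (insert ?x (insert ?S P)))))
      (Suc (Suc (Suc (Suc s'))))"
    by (rule circuit_reaches_op) (use one in auto)
  then have "circuit_reaches (insert ((1 + ?x * ?y) * ?g) (insert (1 + ?x * ?y) (insert (?x * ?y)
      (insert ?y (insert ?x (insert ?S P)))))) (Suc (Suc (Suc (Suc (Suc s')))))"
    by (rule circuit_reaches_op) (use inner in auto)
  then have "circuit_reaches (insert ((1 + ?x * ?y) * ?g + ?S) (insert ((1 + ?x * ?y) * ?g) (insert (1 + ?x * ?y)
      (insert (?x * ?y) (insert ?y (insert ?x (insert ?S P))))))) (Suc (Suc (Suc (Suc (Suc (Suc s'))))))"
    by (rule circuit_reaches_op) auto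
  moreover have "card ?K \<le> N"
  proof -
    have "card ?K \<le> card {1..N}"
      using ij by (intro card_mono) auto
    then show ?thesis by simp
  qed
  ultimately show ?thesis
    unfolding ry_interval_step[OF ij(1)] by (elim circuit_reaches_mono) (auto simp: s'_def)
qed

lemma circuit_reaches_Un:
  assumes "finite J" "circuit_reaches P s"
    and "\<And>i P' s'. i \<in> J \<Longrightarrow> P \<subseteq> P' \<Longrightarrow> circuit_reaches P' s' \<Longrightarrow> circuit_reaches (insert (h i) P') (s' + c)"
  shows "circuit_reaches (P \<union> h ` J) (s + card J * c)"
  using assms(1,3)
proof (induction J rule: finite_induct)
  case empty
  then show ?case using assms(2) by simp
next
  case (insert i J)
  then have "circuit_reaches (P \<union> h ` J) (s + card J * c)" by blast
  then have "circuit_reaches (insert (h i) (P \<union> h ` J)) (s + card J * c + c)"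
    by (intro insert.prems) auto
  then show ?case
    using insert.hyps by (simp add: algebra_simps)
qed

text \<open>Dynamic programming by interval length: each length contributes at most \<open>N\<close>
  intervals, and all shorter ones are already available.\<close>

lemma circuit_reaches_ry_intervals:
  fixes N t :: nat
  defines "P \<equiv> \<lambda>t. insert 1 {ry_interval i j :: (ry_var, 'a::comm_ring_1) mpoly | i j. 1 \<le> i \<and> j \<le> N \<and> Suc j - i \<le> t}"
  shows "circuit_reaches (P t) (1 + t * (N * (7 + 4 * N)))"
proof (induction t)
  case 0
  have "P 0 = {1}"
    by (auto simp: P_def ry_interval_empty)
  then show ?case
    using circuit_reaches_mconst[OF circuit_reaches_empty, of 1] by (simp add: mconst_def)
next
  case (Suc t)
  let ?J = "{i \<in> {1..N}. i + t \<le> N}"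
  have "circuit_reaches (P t \<union> (\<lambda>i. ry_interval i (i + t)) ` ?J)
      (1 + t * (N * (7 + 4 * N)) + card ?J * (7 + 4 * N))"
  proof (rule circuit_reaches_Un[OF _ Suc])
    fix i s and P' :: "(ry_var, 'a) mpoly set"
    assume i: "i \<in> ?J" and P': "P t \<subseteq> P'" "circuit_reaches P' s"
    have in_P: "ry_interval a b \<in> P'" if "1 \<le> a" "b \<le> N" "Suc b - a \<le> t" for a b
      using that P'(1) by (auto simp: P_def)
    show "circuit_reaches (insert (ry_interval i (i + t)) P') (s + (7 + 4 * N))"
      using i P'(1) by (intro circuit_reaches_ry_step[OF P'(2)] in_P conjI) (auto simp: P_def)
  qed simp
  moreover have "P (Suc t) \<subseteq> P t \<union> (\<lambda>i. ry_interval i (i + t)) ` ?J"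
  proof
    fix p assume "p \<in> P (Suc t)"
    then consider "p \<in> P t" | i j where "p = ry_interval i j" "1 \<le> i" "j \<le> N" "Suc j - i = Suc t"
      unfolding P_def by (auto simp: le_Suc_eq)
    then show "p \<in> P t \<union> (\<lambda>i. ry_interval i (i + t)) ` ?J"
    proof cases
      case 2
      then have "j = i + t" by linarith
      then show ?thesis using 2 by auto
    qed simp
  qed
  moreover have "card ?J * (7 + 4 * N) \<le> N * (7 + 4 * N)"
  proof -
    have "card ?J \<le> card {1..N}" by (intro card_mono) auto
    then show ?thesis by (simp only: card_atLeastAtMost diff_Suc_1 mult_le_mono1)
  qed
  ultimately show ?case
    by (elim circuit_reaches_mono) auto
qed

lemma in_VP_ry_poly: "in_VP (ry_poly :: nat \<Rightarrow> (ry_var, 'a::comm_ring_1) mpoly)"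
proof -
  have "total_degree (ry_poly n :: (ry_var, 'a) mpoly) \<le> poly [:0, 6:] n" for n
    using total_degree_ry_interval[of 1 "2 * n", where 'a = 'a] by (simp add: ry_poly_def)
  moreover have "\<exists>C. circuit_computes C (ry_poly n :: (ry_var, 'a) mpoly) \<and> length C \<le> poly [:3, 0, 28, 32:] n" for n
  proof -
    have "ry_poly n \<in> insert 1 {ry_interval i j :: (ry_var, 'a) mpoly | i j. 1 \<le> i \<and> j \<le> 2 * n \<and> Suc j - i \<le> 2 * n}"
      unfolding ry_poly_def by force
    then have "\<exists>C. circuit_computes C (ry_poly n :: (ry_var, 'a) mpoly) \<and>
        length C \<le> 1 + (2 * n) * ((2 * n) * (7 + 4 * (2 * n))) + 2"
      by (rule circuit_reaches_imp_computes[OF circuit_reaches_ry_intervals[of "2 * n" "2 * n"]])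
    then show ?thesis by (simp add: algebra_simps numeral_3_eq_3)
  qed
  ultimately show ?thesis
    unfolding in_VP_def by blast
qed

section \<open>The lower bound\<close>

text \<open>The monomial \<open>m\<close> is chosen after \<open>A\<close>, which is harmless
  because the weights do not mention it. Indexing columns by the images under the matching
  \<open>f\<close> exhibits an identity matrix of size 2^n.\<close>

lemma two_power_le_sum_weight:
  fixes F :: "nat \<Rightarrow> (ry_var, 'a::field) formula"
  assumes F: "\<And>i. i \<in> {1..s} \<Longrightarrow> read_once_formula (F i)"
    and sum: "(\<Sum>i = 1..s. formula_poly (F i)) = ry_poly n"
    and A: "A \<subseteq> {1..2*n}" "card A = n"
  shows "2 ^ n \<le> (\<Sum>i = 1..s. weight (X ` {1..2*n}) (X ` A) (F i))"
proof -
  let ?g = "ry_poly n :: (ry_var, 'a) mpoly"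
  define Q where "Q = X ` {1..2*n}"
  define B where "B = {1..2*n} - A"
  have AB: "A \<inter> {1..2*n} = A" "{1..2*n} - A = B" and finA: "finite A" "finite B"
    using A(1) finite_subset by (auto simp: B_def)
  obtain m f where "ry_matching TYPE('a) A 1 (2 * n) m f"
    using ry_matching_exists[of 1 A "2 * n"] A AB by auto
  then have m: "finite m" "m \<inter> range X = {}" and f: "bij_betw f A B"
    and coeff: "\<And>K. K \<subseteq> {1..2*n} \<Longrightarrow> sqfree_coeff ?g (m \<union> X ` K) =
      (if \<forall>a\<in>A. a \<in> K \<longleftrightarrow> f a \<in> K then 1 else 0)"
    unfolding ry_matching_def ry_poly_def AB by auto
  have "\<exists>r. rank_le (coeff_matrix (X ` A) (X ` B) (formula_poly (F i)) m) r \<and> real r \<le> weight Q (X ` A) (F i)"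
    if "i \<in> {1..s}" for i
  proof (rule coeff_matrix_rank_le_weight[OF _ _ _ _ F[OF that] m(1)])
    show "Q = X ` A \<union> X ` B" using A(1) by (auto simp: Q_def B_def)
    show "m \<inter> Q = {}" using m(2) by (auto simp: Q_def)
  qed (use finA in \<open>auto simp: B_def\<close>)
  then obtain r where r: "\<And>i. i \<in> {1..s} \<Longrightarrow> rank_le (coeff_matrix (X ` A) (X ` B) (formula_poly (F i)) m) (r i)"
      "\<And>i. i \<in> {1..s} \<Longrightarrow> real (r i) \<le> weight Q (X ` A) (F i)"
    by metis
  have "rank_le (\<lambda>S T. \<Sum>i = 1..s. coeff_matrix (X ` A) (X ` B) (formula_poly (F i)) m S T) (\<Sum>i = 1..s. r i)"
    by (intro rank_le_sum r) auto
  also have "(\<lambda>S T. \<Sum>i = 1..s. coeff_matrix (X ` A) (X ` B) (formula_poly (F i)) m S T) =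
      coeff_matrix (X ` A) (X ` B) ?g m"
    by (simp add: coeff_matrix_def sum[symmetric] sqfree_coeff_sum fun_eq_iff)
  finally have rank: "rank_le (\<lambda>S T. coeff_matrix (X ` A) (X ` B) ?g m (X ` S) (X ` T)) (\<Sum>i = 1..s. r i)"
    using rank_le_scale_compose[of _ _ "\<lambda>_. 1" "\<lambda>_. 1" "image X" "image X"] by fastforce
  have inj: "inj_on (image f) (Pow A)"
    using f by (simp add: bij_betw_def inj_on_image_Pow)
  have perm: "coeff_matrix (X ` A) (X ` B) ?g m (X ` S) (X ` f ` S') = (if S = S' then 1 else 0)"
    if S: "S \<in> Pow A" "S' \<in> Pow A" for S S'
  proof -
    have fS': "f ` S' \<subseteq> B"
      using f S by (auto dest: bij_betwE)
    have "X ` S \<inter> X ` A = X ` S" "X ` f ` S' \<inter> X ` B = X ` f ` S'"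
      using S fS' by auto
    then have "coeff_matrix (X ` A) (X ` B) ?g m (X ` S) (X ` f ` S') = sqfree_coeff ?g (m \<union> X ` (S \<union> f ` S'))"
      by (simp add: coeff_matrix_def image_Un Un_assoc)
    also have "\<dots> = (if \<forall>a\<in>A. a \<in> S \<union> f ` S' \<longleftrightarrow> f a \<in> S \<union> f ` S' then 1 else 0)"
      using S fS' A(1) by (intro coeff) (auto simp: B_def)
    also have "(\<forall>a\<in>A. a \<in> S \<union> f ` S' \<longleftrightarrow> f a \<in> S \<union> f ` S') \<longleftrightarrow> (\<forall>a\<in>A. a \<in> S \<longleftrightarrow> a \<in> S')"
    proof (rule ball_cong[OF refl])
      fix a assume a: "a \<in> A"
      have "a \<notin> f ` S'" "f a \<notin> S"
        using a f fS' S bij_betwE[OF f] by (auto simp: B_def)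
      moreover have "f a \<in> f ` S' \<longleftrightarrow> a \<in> S'"
        using a S f by (intro inj_on_image_mem_iff[of f A]) (auto simp: bij_betw_def)
      ultimately show "(a \<in> S \<union> f ` S' \<longleftrightarrow> f a \<in> S \<union> f ` S') \<longleftrightarrow> (a \<in> S \<longleftrightarrow> a \<in> S')"
        by blast
    qed
    also have "\<dots> \<longleftrightarrow> S = S'" using S by auto
    finally show ?thesis .
  qed
  have "card (Pow A) \<le> (\<Sum>i = 1..s. r i)"
    by (rule rank_le_permutation_matrix[OF rank _ inj perm]) (use finA in auto)
  then have "2 ^ n \<le> (\<Sum>i = 1..s. r i)"
    using A finA by (simp add: card_Pow)
  then have "2 ^ n \<le> (\<Sum>i = 1..s. real (r i))"
    by (metis of_nat_le_iff of_nat_numeral of_nat_power of_nat_sum)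
  also have "\<dots> \<le> (\<Sum>i = 1..s. weight Q (X ` A) (F i))"
    by (intro sum_mono r) auto
  finally show ?thesis by (simp add: Q_def)
qed

text \<open>Double counting over the balanced \<open>A\<close>: each contributes at least 2^n, and
  each formula absorbs at most \<open>(799/100) ^ n\<close> in total. The base 800/799 is 8 divided
  by 799/100.\<close>

lemma read_once_summands_ge:
  fixes f :: "nat \<Rightarrow> (ry_var, 'a::field) mpoly"
  assumes n: "n > 0" and f: "\<And>i. i \<in> {1..s} \<Longrightarrow> read_once_poly (f i)" and sum: "(\<Sum>i = 1..s. f i) = ry_poly n"
  shows "(800/799) ^ n / (2 * real n) \<le> real s"
proof -
  obtain F where F: "\<And>i. i \<in> {1..s} \<Longrightarrow> read_once_formula (F i) \<and> formula_poly (F i) = f i"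
    using f unfolding read_once_poly_def by metis
  let ?Q = "X ` {1..2*n}" and ?\<A> = "{A. A \<subseteq> {1..2*n} \<and> card A = n}"
  have sum': "(\<Sum>i = 1..s. formula_poly (F i)) = ry_poly n"
    using F sum by simp
  have inj: "inj_on (image X) (Pow {1..2*n})"
    by (simp add: inj_on_def inj_image_eq_iff)
  have all: "(\<Sum>A\<in>?\<A>. weight ?Q (X ` A) (F i)) \<le> (799/100) ^ n" if i: "i \<in> {1..s}" for i
  proof -
    have "(\<Sum>A\<in>?\<A>. weight ?Q (X ` A) (F i)) \<le> (\<Sum>A\<in>Pow {1..2*n}. weight ?Q (X ` A) (F i))"
      by (intro sum_mono2) (auto simp: weight_nonneg)
    also have "\<dots> = (\<Sum>A\<in>Pow ?Q. weight ?Q A (F i))"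
      using sum.reindex[OF inj, of "\<lambda>A. weight ?Q A (F i)"] by (simp add: image_Pow_surj[OF refl])
    also have "\<dots> \<le> (2 * sqrt (799/400)) ^ card ?Q"
      using F[OF i] by (intro sum_weight_le) auto
    also have "card ?Q = 2 * n"
      by (subst card_image) (auto simp: inj_on_def)
    also have "(2 * sqrt (799/400)) ^ (2 * n) = (799/100) ^ n"
      by (simp add: power_mult power_mult_distrib)
    finally show ?thesis .
  qed
  have "4 ^ n / (2 * real n) * 2 ^ n \<le> real ((2 * n) choose n) * 2 ^ n"
    by (intro mult_right_mono central_binomial_lower_bound n) auto
  also have "\<dots> = (\<Sum>A\<in>?\<A>. 2 ^ n)"
    by (simp add: n_subsets)
  also have "\<dots> \<le> (\<Sum>A\<in>?\<A>. \<Sum>i = 1..s. weight ?Q (X ` A) (F i))"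
    using F by (intro sum_mono two_power_le_sum_weight sum') auto
  also have "\<dots> = (\<Sum>i = 1..s. \<Sum>A\<in>?\<A>. weight ?Q (X ` A) (F i))"
    by (rule sum.swap)
  also have "\<dots> \<le> (\<Sum>i = 1..s. (799/100) ^ n)"
    by (intro sum_mono all)
  also have "\<dots> = real s * (799/100) ^ n"
    by simp
  finally have "4 ^ n / (2 * real n) * 2 ^ n / (799/100) ^ n \<le> real s"
    by (subst pos_divide_le_eq) simp_all
  also have "4 ^ n / (2 * real n) * 2 ^ n / (799/100) ^ n = (4 * 2 / (799/100)) ^ n / (2 * real n)"
    by (simp only: power_mult_distrib power_divide) simp
  finally show ?thesis by simp
qed

theorem theorem4:
  shows "in_VP (ry_poly :: nat \<Rightarrow> (ry_var, 'a::field) mpoly) \<and>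
    (\<forall>n \<ge> 1. (ry_poly n :: (ry_var, 'a) mpoly) \<in> mpolys_over (ry_vars n)) \<and>
    (\<exists>c :: real. c > 0 \<and> (\<exists>n0 :: nat. \<forall>n \<ge> n0.
      \<forall>(s :: nat) (f :: nat \<Rightarrow> (ry_var, 'a) mpoly).
        (\<forall>i \<in> {1..s}. f i \<in> mpolys_over (ry_vars n) \<and> read_once_poly (f i)) \<longrightarrow>
        (\<Sum>i = 1..s. f i) = ry_poly n \<longrightarrow>
        real s \<ge> 2 powr (c * real n / log 2 (real n))))"
proof (intro conjI allI impI)
  show "in_VP (ry_poly :: nat \<Rightarrow> (ry_var, 'a) mpoly)"
    by (rule in_VP_ry_poly)
  show "(ry_poly n :: (ry_var, 'a) mpoly) \<in> mpolys_over (ry_vars n)" if "n \<ge> 1" for n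
    unfolding ry_poly_def
    by (rule mpolys_over_mono[OF ry_interval_mpolys_over]) (fastforce simp: ry_interval_vars_def ry_vars_def)
  define \<delta> where "\<delta> = log 2 (800/799 :: real)"
  have \<delta>: "\<delta> > 0" by (simp add: \<delta>_def)
  have "filterlim (\<lambda>n. 2 * real n) at_top sequentially"
    by (intro filterlim_tendsto_pos_mult_at_top[OF tendsto_const] filterlim_real_sequentially) auto
  from filterlim_compose[OF ln_x_over_x_tendsto_0 this]
  \<comment> \<open>Multiplied by \<open>2 * n / ln 2\<close>, this says
    \<open>log 2 (2 * n) < \<delta> / 2 * n\<close>: half of the exponent pays for the denominator
    \<open>2 * n\<close>.\<close>
  have "\<forall>\<^sub>F n in sequentially. ln (2 * real n) / (2 * real n) < \<delta> * ln 2 / 4"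
    using \<delta> by (intro order_tendstoD) auto
  then obtain n1 where n1: "\<And>n. n \<ge> n1 \<Longrightarrow> ln (2 * real n) / (2 * real n) < \<delta> * ln 2 / 4"
    by (auto simp: eventually_sequentially)
  have "2 powr (\<delta> / 2 * real n / log 2 (real n)) \<le> real s"
    if n: "n \<ge> max 2 n1" and f: "\<forall>i \<in> {1..s}. f i \<in> mpolys_over (ry_vars n) \<and> read_once_poly (f i)"
      and sum: "(\<Sum>i = 1..s. f i) = ry_poly n" for n s and f :: "nat \<Rightarrow> (ry_var, 'a) mpoly"
  proof -
    \<comment> \<open>For \<open>n \<ge> 2\<close> dividing by the logarithm only lowers the
      exponent, so the bound obtained without it implies the one claimed.\<close>
    have "log 2 (real n) \<ge> 1" using n by (simp add: le_log_iff)
    then have "\<delta> / 2 * real n / log 2 (real n) \<le> \<delta> / 2 * real n / 1"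
      using \<delta> by (intro divide_left_mono) auto
    moreover have "log 2 (2 * real n) \<le> \<delta> / 2 * real n"
      using n1[of n] n by (simp add: log_def field_simps)
    ultimately have "\<delta> / 2 * real n / log 2 (real n) \<le> \<delta> * real n - log 2 (2 * real n)"
      by simp
    then have "2 powr (\<delta> / 2 * real n / log 2 (real n)) \<le> 2 powr (\<delta> * real n - log 2 (2 * real n))"
      by simp
    also have "\<dots> = (800/799) ^ n / (2 * real n)"
      using n by (simp add: powr_diff \<delta>_def powr_powr[symmetric] powr_realpow)
    also have "\<dots> \<le> real s"
      using n f sum by (intro read_once_summands_ge) auto
    finally show ?thesis .
  qed
  then show "\<exists>c :: real. c > 0 \<and> (\<exists>n0 :: nat. \<forall>n \<ge> n0.
      \<forall>(s :: nat) (f :: nat \<Rightarrow> (ry_var, 'a) mpoly).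
        (\<forall>i \<in> {1..s}. f i \<in> mpolys_over (ry_vars n) \<and> read_once_poly (f i)) \<longrightarrow>
        (\<Sum>i = 1..s. f i) = ry_poly n \<longrightarrow>
        real s \<ge> 2 powr (c * real n / log 2 (real n)))"
    using \<delta> by (intro exI[of _ "\<delta> / 2"] conjI exI[of _ "max 2 n1"] allI impI) auto
qed

end
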